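(* Let $\{\phi_t\}_{t\in\mathbb T^d}$ be a non-singular $\mathbb T^d$-action on a standard Lebesgue space $(S,\mathcal B,\mu)$ with $\sigma$-finite $\mu$, let $w(t,s)$ be as in the context, let $f_0\in L^1(S,\mu)$ and define $f(t,s)=(\widehat\phi_{-t}f_0)(s):=w(t,s)\,f_0(\phi_t(s))$. Then there exists $\widetilde f\in L^1(S,\mu)$ such that $$A_Tf(s)=\frac1{C(T)}\int_{B(T)}f(t,s)\,\lambda(dt)\ \longrightarrow\ \widetilde f(s)$$ stochastically (locally in measure) as $T\to\infty$. Moreover $\widetilde f$ is invariant: $\widehat\phi_t\widetilde f=\widetilde f$ $\mu$-a.e. for all $t\in\mathbb T^d$.
   Context: $\mathbb T$ denotes either $\mathbb Z$ or $\mathbb R$; $\lambda$ is counting measure on $\mathbb Z^d$ or Lebesgue measure on $\mathbb R^d$. $B(T)=(-T,T]^d\cap\mathbb T^d$ and $C(T)=(2T)^d$. A non-singular $\mathbb T^d$-action is a family $\{\phi_t\}_{t\in\mathbb T^d}$ of invertible bi-measurable maps with $\mu\circ\phi_t^{-1}\sim\mu$, $\phi_0=\mathrm{id}$, $\phi_{u+v}=\phi_u\circ\phi_v$, and $(t,s)\mapsto\phi_t(s)$ jointly measurable. $w(t,s)$ is a strictly positive jointly measurable function such that for each $t$, $w(t,\cdot)=\frac{d\mu\circ\phi_t}{d\mu}$ $\mu$-a.e., and $w(t+h,s)=w(h,s)\,w(t,\phi_h(s))$ for all $t,h\in\mathbb T^d$, $s\in S$ (such a version exists). The dual operator of a non-singular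 $\phi$ is $\widehat\phi g=\frac{d\mu\circ\phi^{-1}}{d\mu}\,g\circ\phi^{-1}$. Stochastic convergence $g_T\to g$ means $\mu(\{|g_T-g|>\epsilon\}\cap B)\to0$ for all $\epsilon>0$ and all $B\in\mathcal B$ with $\mu(B)<\infty$. *)

theory Defs
  imports "HOL-Probability.Probability"
begin

text \<open>The index group \<open>\<T>\<^sup>d\<close>, embedded in \<open>real^'d\<close>: for \<open>disc = True\<close> it is the
  integer lattice \<open>\<int>\<^sup>d\<close> (with counting measure), for \<open>disc = False\<close> it is \<open>\<real>\<^sup>d\<close>
  (with Lebesgue measure).\<close>

definition lattice :: "(real^'d) set" where
  "lattice = {x. \<forall>i. x $ i \<in> \<int>}"

definition Tset :: "bool \<Rightarrow> (real^'d) set" where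
  "Tset disc = (if disc then lattice else UNIV)"

definition lam :: "bool \<Rightarrow> (real^'d) measure" where
  "lam disc = (if disc then count_space lattice else lborel)"

definition Bbox :: "bool \<Rightarrow> real \<Rightarrow> (real^'d) set" where
  "Bbox disc T = {x \<in> Tset disc. \<forall>i. - T < x $ i \<and> x $ i \<le> T}"

definition Cvol :: "real \<Rightarrow> real" where
  "Cvol T = (2 * T) ^ CARD('d)"

definition time_filter :: "bool \<Rightarrow> real filter" where
  "time_filter disc = (if disc then filtermap real_of_int at_top else at_top)"

definition avg :: "bool \<Rightarrow> real \<Rightarrow> ((real^'d) \<Rightarrow> 's \<Rightarrow> real) \<Rightarrow> 's \<Rightarrow> real" where
  "avg disc T f s = (1 / Cvol TYPE('d) T) * (LINT t : Bbox disc T | lam disc. f t s)"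

definition dual_op :: "'s measure \<Rightarrow> ('s \<Rightarrow> 's) \<Rightarrow> ('s \<Rightarrow> real) \<Rightarrow> 's \<Rightarrow> real" where
  "dual_op M \<phi> g s = enn2real (RN_deriv M (distr M M \<phi>) s) * g (inv_into (space M) \<phi> s)"

definition stoch_conv :: "'s measure \<Rightarrow> ('i \<Rightarrow> 's \<Rightarrow> real) \<Rightarrow> ('s \<Rightarrow> real) \<Rightarrow> 'i filter \<Rightarrow> bool" where
  "stoch_conv M g h F \<longleftrightarrow>
     (\<forall>\<epsilon>>0. \<forall>B\<in>sets M. emeasure M B < \<infinity> \<longrightarrow>
        ((\<lambda>T. measure M ({s \<in> space M. \<bar>g T s - h s\<bar> > \<epsilon>} \<inter> B)) \<longlongrightarrow> 0) F)"

end

theory Submission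
  imports Defs
begin

text \<open>
  Let \<open>U\<^sub>t g = w(t, \<cdot>) g \<circ> \<phi>\<^sub>t\<close>, a group of positive isometries of \<open>L\<^sup>1\<close>, let \<open>A\<^sub>T\<close> be the box averages
  and let \<open>f \<ge> 0\<close>. Consider convex sets \<open>K\<^sub>n\<close> of almost invariant averages of \<open>f\<close>, decreasing in \<open>n\<close> and
  containing \<open>A\<^sub>T f\<close> for all large \<open>T\<close>, and minimise over them the strictly convex functional
  \<open>E(g) = \<integral> exp(-g) dN\<close>, where \<open>N\<close> is a finite measure equivalent to \<open>\<mu>\<close>. Uniform convexity makes a
  minimising sequence \<open>u\<^sub>n \<in> K\<^sub>n\<close> converge almost everywhere; by Fatou the limit \<open>g\<close> is integrable, and it
  is invariant.

  Since \<open>(g - u\<^sub>n)\<^sup>+ \<le> g\<close>, dominated convergence gives \<open>(g - u\<^sub>n)\<^sup>+ \<rightarrow> 0\<close> in \<open>L\<^sup>1\<close>. Applying the contraction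
  \<open>A\<^sub>T\<close> and using \<open>A\<^sub>T g = g\<close> and \<open>A\<^sub>T u\<^sub>n \<approx> A\<^sub>T f\<close>, one gets \<open>(g - A\<^sub>T f)\<^sup>+ \<rightarrow> 0\<close> in \<open>L\<^sup>1\<close>. On the other hand
  \<open>liminf E(A\<^sub>T f) \<ge> E(g)\<close> by minimality. Together these force \<open>exp(-A\<^sub>T f) \<rightarrow> exp(-g)\<close> in \<open>L\<^sup>1(N)\<close>, which
  is local convergence in measure. For general \<open>f\<close> split into positive and negative parts.
\<close>

section \<open>The exponential on extended nonnegative reals\<close>

text \<open>The value 0 at infinity is the continuous extension of the exponential. Since the values
  stay in the unit interval, the integral against a finite measure exists for every measurable
  function.\<close>

definition expneg :: "ennreal \<Rightarrow> real" where
  "expneg x = (if x = \<top> then 0 else exp (- enn2real x))"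

lemma expneg_top [simp]: "expneg \<top> = 0"
  by (simp add: expneg_def)

lemma expneg_ennreal: "0 \<le> r \<Longrightarrow> expneg (ennreal r) = exp (- r)"
  by (simp add: expneg_def)

lemma expneg_nonneg [simp]: "0 \<le> expneg x"
  by (simp add: expneg_def)

lemma expneg_le_1 [simp]: "expneg x \<le> 1"
  by (simp add: expneg_def)

lemma expneg_measurable [measurable]: "expneg \<in> borel_measurable borel"
  unfolding expneg_def[abs_def] by measurable

lemma expneg_antimono: "x \<le> y \<Longrightarrow> expneg y \<le> expneg x"
  by (cases x; cases y) (auto simp: expneg_ennreal top_unique)

lemma expneg_add: "expneg (x + y) = expneg x * expneg y"
  by (cases x; cases y) (auto simp: expneg_ennreal exp_add[symmetric] simp flip: ennreal_plus)

text \<open>Twice the midpoint is x + y, so additivity makes the left side a nonnegative square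
  root. The geometric mean is what later turns the convexity defect of the energy into a perfect
  square.\<close>

lemma expneg_midpoint: "expneg ((x + y) / 2) = sqrt (expneg x * expneg y)"
proof -
  have "(x + y) / 2 + (x + y) / 2 = x + y"
    by (cases "x + y") (auto simp: ennreal_divide_numeral ennreal_top_divide simp flip: ennreal_plus)
  then have "expneg ((x + y) / 2) * expneg ((x + y) / 2) = expneg x * expneg y"
    by (metis expneg_add)
  then show ?thesis
    by (metis expneg_nonneg real_sqrt_mult_self abs_of_nonneg real_sqrt_mult)
qed

lemma one_minus_expneg_le: "ennreal (1 - expneg x) \<le> x"
proof (cases x)
  case (real r)
  have "1 - exp (- r) \<le> r"
    using exp_ge_add_one_self[of "- r"] by simp
  then show ?thesis
    using real by (auto simp: expneg_ennreal intro: ennreal_leI)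
qed simp

text \<open>Antitonicity and multiplicativity turn the additive error k into the factor
  \<open>expneg k\<close>. By \<open>one_minus_expneg_le\<close> the resulting error is again at
  most k, so one-sided estimates in mean survive exponentiation.\<close>

lemma expneg_diff_le:
  assumes "g \<le> a + k"
  shows "expneg a - expneg g \<le> 1 - expneg k"
proof -
  have "expneg a * expneg k \<le> expneg g"
    using expneg_antimono[OF assms] by (simp add: expneg_add)
  moreover have "expneg a * (1 - expneg k) \<le> 1 * (1 - expneg k)"
    by (intro mult_right_mono) auto
  ultimately show ?thesis
    by (simp add: algebra_simps)
qed

text \<open>The lower bound does not involve a, so it can act as a fixed weight while a runs through
  the averages. Above g the exponential shrinks at least by the factor exp (- \<epsilon>); below g
  it grows at least by the inverse factor.\<close>

lemma expneg_separation:
  assumes fin: "a \<noteq> \<top>" "g \<noteq> \<top>" and gap: "\<epsilon> < \<bar>enn2real a - enn2real g\<bar>" and \<epsilon>: "0 < \<epsilon>"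
  shows "expneg g * (1 - exp (- \<epsilon>)) \<le> \<bar>expneg a - expneg g\<bar>"
proof -
  define x y where "x = enn2real a" and "y = enn2real g"
  have eq: "expneg a = exp (- x)" "expneg g = exp (- y)"
    using fin by (auto simp: expneg_def x_def y_def)
  have "exp (- y) * (1 - exp (- \<epsilon>)) \<le> \<bar>exp (- x) - exp (- y)\<bar>"
  proof (cases "x > y")
    case True
    then have "y + \<epsilon> \<le> x"
      using gap by (simp add: x_def y_def)
    then have "exp (- x) \<le> exp (- y) * exp (- \<epsilon>)"
      by (simp flip: exp_add)
    then show ?thesis
      by (simp add: algebra_simps)
  next
    case False
    then have "x + \<epsilon> \<le> y"
      using gap by (simp add: x_def y_def)
    then have "exp (- y) \<le> exp (- x) * exp (- \<epsilon>)"
      by (simp flip: exp_add)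
    \<comment> \<open>With q = exp (- \<epsilon>) the claim reduces to q (2 - q) \<le> 1, which is
      the nonnegativity of (1 - q) squared.\<close>
    moreover have "exp (- x) * (exp (- \<epsilon>) * (2 - exp (- \<epsilon>))) \<le> exp (- x) * 1"
    proof (intro mult_left_mono)
      show "exp (- \<epsilon>) * (2 - exp (- \<epsilon>)) \<le> 1"
        using zero_le_power2[of "1 - exp (- \<epsilon>)"] by (simp add: power2_eq_square algebra_simps)
    qed simp
    moreover have "exp (- y) * (2 - exp (- \<epsilon>)) \<le> exp (- x) * exp (- \<epsilon>) * (2 - exp (- \<epsilon>))"
      using calculation(1) \<epsilon> by (intro mult_right_mono) (auto simp: exp_le_one_iff intro: order_trans[of _ 1])
    ultimately show ?thesis
      by (simp add: algebra_simps)
  qed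
  then show ?thesis
    by (simp add: eq)
qed

section \<open>Convergence of functions versus convergence of their exponentials\<close>

lemma tendsto_expneg:
  assumes "(f \<longlongrightarrow> x) F" "x \<noteq> \<top>"
  shows "((\<lambda>n. expneg (f n)) \<longlongrightarrow> expneg x) F"
proof -
  have "\<forall>\<^sub>F n in F. f n < \<top>"
    using assms by (intro order_tendstoD) (auto simp: top.not_eq_extremum)
  then have "\<forall>\<^sub>F n in F. exp (- enn2real (f n)) = expneg (f n)"
    by eventually_elim (auto simp: expneg_def)
  moreover have "((\<lambda>n. exp (- enn2real (f n))) \<longlongrightarrow> exp (- enn2real x)) F"
    using assms by (auto intro!: tendsto_intros simp: top.not_eq_extremum)
  ultimately show ?thesis
    using assms(2) by (subst (asm) tendsto_cong) (auto simp: expneg_def)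
qed

text \<open>The logarithm can be applied as soon as c is positive. A finite liminf keeps f below
  some level L infinitely often, hence c is at least exp (- L); this excludes escape to
  infinity.\<close>

lemma tendsto_of_expneg:
  assumes lim: "(\<lambda>n. expneg (f n)) \<longlonglongrightarrow> c" and fin: "liminf f \<noteq> \<top>"
  shows "f \<longlonglongrightarrow> liminf f"
proof -
  obtain L where L: "0 \<le> L" "liminf f < ennreal L"
    using fin by (metis dense ennreal_cases top.not_eq_extremum infinity_ennreal_def not_less_iff_gr_or_eq top.extremum_strict)
  have "\<exists>\<^sub>F n in sequentially. f n < ennreal L"
    using L(2) unfolding frequently_def not_less
    using Liminf_bounded leD by blast
  then have "\<exists>\<^sub>F n in sequentially. exp (- L) \<le> expneg (f n)"
    by (rule frequently_elim1) (metis L(1) expneg_antimono expneg_ennreal less_imp_le)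
  then have "exp (- L) \<le> c"
    using order_tendstoD(2)[OF lim, of "exp (- L)"] unfolding frequently_def not_le by argo
  then have c: "0 < c"
    using exp_gt_zero[of "- L"] by linarith
  have "\<forall>\<^sub>F n in sequentially. 0 < expneg (f n)"
    using lim c by (rule order_tendstoD)
  then have "\<forall>\<^sub>F n in sequentially. ennreal (- ln (expneg (f n))) = f n"
    by eventually_elim (auto simp: expneg_def top.not_eq_extremum split: if_splits)
  moreover have "(\<lambda>n. ennreal (- ln (expneg (f n)))) \<longlonglongrightarrow> ennreal (- ln c)"
    using lim c by (intro tendsto_ennrealI tendsto_intros) auto
  ultimately have "f \<longlonglongrightarrow> ennreal (- ln c)"
    by (subst (asm) tendsto_cong)
  then show ?thesis
    using lim_imp_Liminf by force
qed

section \<open>Weights and convergence in measure\<close>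

text \<open>The set B is split according to the size of p. Where p is below 1 / (m + 1), continuity
  from above makes the part of B small, as p is positive almost everywhere and B has finite measure;
  on the rest Markov's inequality applies with constant m + 1.\<close>

lemma measure_tendsto_0_of_weight:
  fixes p :: "'s \<Rightarrow> real"
  assumes [measurable]: "p \<in> borel_measurable M" and pos: "AE s in M. 0 < p s"
    and B [measurable]: "B \<in> sets M" and fin: "emeasure M B < \<infinity>"
    and X [measurable]: "\<And>T. X T \<in> sets M"
    and lim: "((\<lambda>T. \<integral>\<^sup>+s. ennreal (p s) * indicator (X T) s \<partial>M) \<longlongrightarrow> 0) F"
  shows "((\<lambda>T. measure M (X T \<inter> B)) \<longlongrightarrow> 0) F"
proof (rule order_tendstoI)
  fix e :: real assume "0 < e"
  define D where "D m = {s\<in>space M. p s < inverse (real (Suc m))}" for m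
  have D [measurable]: "D m \<in> sets M" for m
    unfolding D_def by measurable
  have "(\<lambda>m. measure M (D m \<inter> B)) \<longlonglongrightarrow> measure M (\<Inter>m. D m \<inter> B)"
  proof (rule Lim_measure_decseq)
    show "range (\<lambda>m. D m \<inter> B) \<subseteq> sets M" by auto
    show "decseq (\<lambda>m. D m \<inter> B)"
      unfolding decseq_def D_def
      by (auto elim!: order.strict_trans2 intro!: le_imp_inverse_le)
    show "emeasure M (D m \<inter> B) \<noteq> \<infinity>" for m
      using fin emeasure_mono[of "D m \<inter> B" B M] by (auto simp: top_unique less_top)
  qed
  moreover have "measure M (\<Inter>m. D m \<inter> B) = 0"
  proof -
    have "AE s in M. s \<notin> (\<Inter>m. D m \<inter> B)"
      using pos
    proof eventually_elim
      case (elim s)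
      then obtain m where "inverse (real (Suc m)) < p s"
        using reals_Archimedean by blast
      then have "s \<notin> D m"
        by (simp add: D_def)
      then show ?case by blast
    qed
    then have "emeasure M (\<Inter>m. D m \<inter> B) = 0"
      by (intro AE_iff_measurable[THEN iffD1, rotated 2])
        (auto dest: sets.sets_into_space simp: D_def)
    then show ?thesis by (simp add: measure_def)
  qed
  ultimately have "\<forall>\<^sub>F m in sequentially. measure M (D m \<inter> B) < e / 2"
    using \<open>0 < e\<close> by (intro order_tendstoD) auto
  then obtain m where m: "measure M (D m \<inter> B) < e / 2"
    by (auto simp: eventually_sequentially)
  have "\<forall>\<^sub>F T in F. (\<integral>\<^sup>+s. ennreal (p s) * indicator (X T) s \<partial>M) < ennreal (e / 2 / real (Suc m))"
    using lim \<open>0 < e\<close> by (intro order_tendstoD) auto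
  then show "\<forall>\<^sub>F T in F. measure M (X T \<inter> B) < e"
  proof eventually_elim
    case (elim T)
    have "emeasure M (X T \<inter> B - D m) = (\<integral>\<^sup>+s. indicator (X T \<inter> B - D m) s \<partial>M)"
      by simp
    also have "\<dots> \<le> (\<integral>\<^sup>+s. ennreal (Suc m) * (ennreal (p s) * indicator (X T) s) \<partial>M)"
    proof (rule nn_integral_mono)
      fix s assume s: "s \<in> space M"
      show "indicator (X T \<inter> B - D m) s \<le> ennreal (Suc m) * (ennreal (p s) * indicator (X T) s)"
      proof (cases "s \<in> X T \<inter> B - D m")
        case True
        then have "inverse (real (Suc m)) \<le> p s"
          using s by (auto simp: D_def)
        then have "1 \<le> real (Suc m) * p s"
          by (simp add: field_simps)
        then have "1 \<le> ennreal (Suc m) * ennreal (p s)"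
          by (subst ennreal_mult'[symmetric]) (auto simp del: of_nat_Suc simp flip: ennreal_1 intro: ennreal_leI)
        then show ?thesis using True by simp
      qed simp
    qed
    also have "\<dots> = ennreal (Suc m) * (\<integral>\<^sup>+s. ennreal (p s) * indicator (X T) s \<partial>M)"
      by (intro nn_integral_cmult) measurable
    also have "\<dots> < ennreal (Suc m) * ennreal (e / 2 / real (Suc m))"
      using elim by (intro ennreal_mult_strict_left_mono) (auto simp del: of_nat_Suc)
    also have "\<dots> = ennreal (e / 2)"
      using \<open>0 < e\<close> by (subst ennreal_mult[symmetric]) (auto simp del: of_nat_Suc)
    finally have "emeasure M (X T \<inter> B - D m) < ennreal (e / 2)" .
    then have "measure M (X T \<inter> B - D m) < e / 2"
      using \<open>0 < e\<close> enn2real_less_iff[of "emeasure M (X T \<inter> B - D m)" "e / 2"]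
      unfolding measure_def by (cases "emeasure M (X T \<inter> B - D m)") (auto simp: ennreal_less_iff)
    moreover have "measure M (X T \<inter> B) \<le> measure M ((X T \<inter> B - D m) \<union> (D m \<inter> B))"
      using fin by (intro measure_mono_fmeasurable fmeasurableI2[OF fmeasurableI[OF B]])
        (auto simp: less_top)
    moreover have "\<dots> \<le> measure M (X T \<inter> B - D m) + measure M (D m \<inter> B)"
      by (intro measure_Un_le) auto
    ultimately show ?case
      using m by linarith
  qed
next
  fix a :: real assume "a < 0"
  then show "\<forall>\<^sub>F T in F. a < measure M (X T \<inter> B)"
    by (intro always_eventually allI) (rule less_le_trans[OF _ measure_nonneg])
qed

text \<open>The bound 1 puts the measure with density q below M, so that smallness of integrals over
  M passes to it. Truncation at 1 also removes infinite values.\<close>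

lemma (in sigma_finite_measure) ex_bounded_integrable_weight:
  obtains q :: "'a \<Rightarrow> real" where "q \<in> borel_measurable M" "\<And>s. s \<in> space M \<Longrightarrow> 0 < q s"
    "\<And>s. q s \<le> 1" "(\<integral>\<^sup>+s. ennreal (q s) \<partial>M) < \<infinity>"
proof -
  obtain h where [measurable]: "h \<in> borel_measurable M" and h: "integral\<^sup>N M h \<noteq> \<infinity>"
    "\<And>s. s \<in> space M \<Longrightarrow> 0 < h s"
    using Ex_finite_integrable_function by blast
  have fin: "min 1 (h s) \<noteq> \<top>" for s
    by (auto simp: min_def top_unique)
  show thesis
  proof (rule that[of "\<lambda>s. enn2real (min 1 (h s))"])
    show "(\<lambda>s. enn2real (min 1 (h s))) \<in> borel_measurable M" by measurable
    show "0 < enn2real (min 1 (h s))" if "s \<in> space M" for s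
      using h(2)[OF that] fin[of s] by (simp add: enn2real_positive_iff less_top)
    show "enn2real (min 1 (h s)) \<le> 1" for s
      by (intro enn2real_leI) auto
    have "(\<integral>\<^sup>+s. ennreal (enn2real (min 1 (h s))) \<partial>M) \<le> (\<integral>\<^sup>+s. h s \<partial>M)"
      using fin by (intro nn_integral_mono) (simp add: less_top)
    then show "(\<integral>\<^sup>+s. ennreal (enn2real (min 1 (h s))) \<partial>M) < \<infinity>"
      using h(1) by (simp add: less_top)
  qed
qed

text \<open>A deviation beyond \<epsilon> forces one of the two parts to deviate beyond \<epsilon> /
  2. The identity is asked for only eventually and almost everywhere because
  \<open>avg_eq_mean_diff\<close> provides it in this form.\<close>

lemma stoch_conv_diff:
  assumes a: "stoch_conv M a a' F" and b: "stoch_conv M b b' F"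
    and [measurable]: "\<And>T. a T \<in> borel_measurable M" "\<And>T. b T \<in> borel_measurable M"
      "a' \<in> borel_measurable M" "b' \<in> borel_measurable M"
    and eq: "\<forall>\<^sub>F T in F. AE s in M. c T s = a T s - b T s"
  shows "stoch_conv M c (\<lambda>s. a' s - b' s) F"
  unfolding stoch_conv_def
proof (intro allI impI ballI)
  fix \<epsilon> :: real and B assume \<epsilon>: "0 < \<epsilon>" and B [measurable]: "B \<in> sets M" and fin: "emeasure M B < \<infinity>"
  define X where "X T = {s \<in> space M. \<epsilon> / 2 < \<bar>a T s - a' s\<bar>} \<inter> B" for T
  define Y where "Y T = {s \<in> space M. \<epsilon> / 2 < \<bar>b T s - b' s\<bar>} \<inter> B" for T
  have [measurable]: "X T \<in> sets M" "Y T \<in> sets M" for T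
    unfolding X_def Y_def by measurable
  have "((\<lambda>T. measure M (X T)) \<longlongrightarrow> 0) F" "((\<lambda>T. measure M (Y T)) \<longlongrightarrow> 0) F"
    using a b \<epsilon> B fin unfolding stoch_conv_def X_def Y_def by (meson half_gt_zero)+
  then have lim: "((\<lambda>T. measure M (X T) + measure M (Y T)) \<longlongrightarrow> 0) F"
    using tendsto_add by fastforce
  have "\<forall>\<^sub>F T in F. measure M ({s \<in> space M. \<epsilon> < \<bar>c T s - (a' s - b' s)\<bar>} \<inter> B) \<le> measure M (X T) + measure M (Y T)"
    using eq
  proof eventually_elim
    case (elim T)
    let ?Z = "{s \<in> space M. \<epsilon> < \<bar>c T s - (a' s - b' s)\<bar>} \<inter> B"
    have "emeasure M ?Z \<le> emeasure M (X T \<union> Y T)"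
    proof (rule emeasure_mono_AE)
      show "AE s in M. s \<in> ?Z \<longrightarrow> s \<in> X T \<union> Y T"
        using elim
      proof eventually_elim
        case (elim s)
        have "\<epsilon> < \<bar>c T s - (a' s - b' s)\<bar> \<Longrightarrow> \<epsilon> / 2 < \<bar>a T s - a' s\<bar> \<or> \<epsilon> / 2 < \<bar>b T s - b' s\<bar>"
          unfolding elim by linarith
        then show ?case
          by (auto simp: X_def Y_def)
      qed
    qed measurable
    moreover have "emeasure M (X T \<union> Y T) \<le> emeasure M B"
      by (intro emeasure_mono) (auto simp: X_def Y_def)
    ultimately have "measure M ?Z \<le> measure M (X T \<union> Y T)"
      unfolding measure_def using fin by (intro enn2real_mono) (auto intro: le_less_trans)
    also have "\<dots> \<le> measure M (X T) + measure M (Y T)"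
      by (intro measure_Un_le) auto
    finally show ?case .
  qed
  then show "((\<lambda>T. measure M ({s \<in> space M. \<epsilon> < \<bar>c T s - (a' s - b' s)\<bar>} \<inter> B)) \<longlongrightarrow> 0) F"
    by (intro tendsto_sandwich[OF _ _ tendsto_const lim]) auto
qed

lemma integrable_enn2real_nn_integral:
  assumes [measurable]: "g \<in> borel_measurable M" and fin: "(\<integral>\<^sup>+s. g s \<partial>M) < \<infinity>"
  shows "integrable M (\<lambda>s. enn2real (g s))"
proof (rule integrableI_nonneg)
  have "(\<integral>\<^sup>+s. ennreal (enn2real (g s)) \<partial>M) \<le> (\<integral>\<^sup>+s. g s \<partial>M)"
    by (intro nn_integral_mono) (metis ennreal_enn2real enn2real_top ennreal_0 top.not_eq_extremum order_refl zero_le)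
  then show "(\<integral>\<^sup>+s. ennreal (enn2real (g s)) \<partial>M) < \<infinity>"
    using fin by (rule le_less_trans)
qed auto

section \<open>Minimising sequences\<close>

text \<open>Near-minimisers are chosen with geometrically small excess energy. Their midpoints stay
  in the sets and cannot beat the infimum, so consecutive terms are close in a quantity that is
  summable, which gives convergence almost everywhere. The last clause expresses minimality of g
  without placing g in any of the sets.\<close>

lemma minimizing_sequence_converges:
  fixes K :: "nat \<Rightarrow> ('s \<Rightarrow> ennreal) set"
  assumes N: "finite_measure N" and sets_eq: "sets N = sets M"
    and AE_iff: "\<And>P. (AE s in N. P s) \<longleftrightarrow> (AE s in M. P s)"
    and ne: "\<And>n. K n \<noteq> {}" and dec: "decseq K"
    and mid: "\<And>n g h. g \<in> K n \<Longrightarrow> h \<in> K n \<Longrightarrow> (\<lambda>s. (g s + h s) / 2) \<in> K n"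
    and meas: "\<And>n g. g \<in> K n \<Longrightarrow> g \<in> borel_measurable M"
    and bound: "\<And>n g. g \<in> K n \<Longrightarrow> (\<integral>\<^sup>+s. g s \<partial>M) \<le> c"
    and c: "c < \<infinity>"
  obtains u g where "\<And>n. u n \<in> K n" "g \<in> borel_measurable M" "(\<integral>\<^sup>+s. g s \<partial>M) \<le> c"
    "AE s in M. (\<lambda>n. u n s) \<longlonglongrightarrow> g s"
    "\<And>e. 0 < e \<Longrightarrow> \<exists>n. \<forall>h\<in>K n. (\<integral>s. expneg (g s) \<partial>N) - e \<le> (\<integral>s. expneg (h s) \<partial>N)"
proof -
  interpret N: finite_measure N by fact
  have [measurable_cong]: "sets M = sets N" by (rule sets_eq[symmetric])
  define I where "I h = (\<integral>s. expneg (h s) \<partial>N)" for h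
  have int: "integrable N (\<lambda>s. expneg (h s))" if "h \<in> borel_measurable M" for h
    using that by (intro N.integrable_const_bound[where B=1]) auto
  have I_nonneg: "0 \<le> I h" for h
    unfolding I_def by (rule Bochner_Integration.integral_nonneg) simp
  have I_le: "I h \<le> measure N (space N)" if "h \<in> borel_measurable M" for h
  proof -
    have "I h \<le> (\<integral>s. 1 \<partial>N)"
      unfolding I_def using int[OF that] by (intro integral_mono) auto
    then show ?thesis by simp
  qed
  \<comment> \<open>The infima increase because the sets shrink, and the mass of N bounds them; the
    energy of g will be at most their limit.\<close>
  define \<sigma> where "\<sigma> n = (INF h\<in>K n. I h)" for n
  have bdd: "bdd_below (I ` K n)" for n
    using I_nonneg by (auto intro: bdd_belowI[of _ 0])
  have \<sigma>_le: "\<sigma> n \<le> I h" if "h \<in> K n" for n h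
    unfolding \<sigma>_def using that by (intro cINF_lower[OF bdd])
  have K_mono: "K n \<subseteq> K m" if "m \<le> n" for m n
    using dec that by (simp add: decseq_def)
  have "incseq \<sigma>"
    unfolding incseq_def \<sigma>_def by (intro allI impI cINF_superset_mono ne bdd K_mono) auto
  moreover have "\<sigma> n \<le> measure N (space N)" for n
    using ne[of n] \<sigma>_le I_le meas by (meson ex_in_conv order_trans)
  ultimately obtain \<sigma>\<^sub>0 where \<sigma>\<^sub>0: "\<sigma> \<longlonglongrightarrow> \<sigma>\<^sub>0" "\<And>n. \<sigma> n \<le> \<sigma>\<^sub>0"
    using incseq_convergent[of \<sigma>] by blast
  have "\<exists>n. \<sigma>\<^sub>0 - (1/4)^j < \<sigma> n" for j :: nat
  proof -
    have "\<forall>\<^sub>F n in sequentially. \<sigma>\<^sub>0 - (1/4)^j < \<sigma> n"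
      using \<sigma>\<^sub>0(1) by (rule order_tendstoD) simp
    then show ?thesis by (auto simp: eventually_sequentially)
  qed
  then obtain n where n: "\<And>j. \<sigma>\<^sub>0 - (1/4)^j < \<sigma> (n j)"
    by metis
  \<comment> \<open>The partial sums dominate n j, so the infimum over K (m j) is close to its
    limit; they are increasing, so two consecutive terms lie in a common set; the summand j ensures
    that u j belongs to K j.\<close>
  define m where "m j = (\<Sum>i\<le>j. n i) + j" for j
  have m: "n j \<le> m j" "j \<le> m j" "m j \<le> m (Suc j)" for j
    by (auto simp: m_def intro: trans_le_add1 member_le_sum)
  have \<sigma>m: "\<sigma>\<^sub>0 - (1/4)^j < \<sigma> (m j)" for j
    using n[of j] \<open>incseq \<sigma>\<close> m(1)[of j] by (meson incseq_def less_le_trans)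
  have "\<exists>h\<in>K (m j). I h < \<sigma>\<^sub>0 + (1/4)^j" for j
  proof -
    have "\<sigma> (m j) < \<sigma>\<^sub>0 + (1/4)^j"
      using \<sigma>\<^sub>0(2)[of "m j"] by (smt (verit) zero_less_power zero_less_divide_1_iff)
    then show ?thesis
      unfolding \<sigma>_def using cINF_less_iff[OF ne bdd] by blast
  qed
  then obtain u where u: "\<And>j. u j \<in> K (m j)" "\<And>j. I (u j) < \<sigma>\<^sub>0 + (1/4)^j"
    by metis
  have uK: "u j \<in> K j" for j
    using u(1) K_mono m(2) by blast
  have um [measurable]: "u j \<in> borel_measurable M" for j
    using meas uK by blast
  \<comment> \<open>By \<open>expneg_midpoint\<close> the product of two consecutive x is the
    exponential of the midpoint, while the squares are the exponentials themselves.\<close>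
  define x where "x j s = sqrt (expneg (u j s))" for j s
  have xm [measurable]: "x j \<in> borel_measurable M" for j
    unfolding x_def by measurable
  have x01: "0 \<le> x j s" "x j s \<le> 1" for j s
    by (auto simp: x_def)
  have x_sq: "x j s * x j s = expneg (u j s)" for j s
    by (simp add: x_def)
  define v where "v j s = (u j s + u (Suc j) s) / 2" for j s
  have v: "v j \<in> K (m j)" for j
    unfolding v_def using u(1) K_mono[OF m(3)] by (intro mid) auto
  have vm: "v j \<in> borel_measurable M" for j
    using meas v by blast
  have xv: "x j s * x (Suc j) s = expneg (v j s)" for j s
    by (simp add: x_def v_def expneg_midpoint real_sqrt_mult)
  \<comment> \<open>Uniform concavity: \<open>exp (- a) + exp (- b) - 2 * exp (- (a + b) / 2)\<close> is a perfect square.\<close>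
  have D: "(\<integral>s. (x j s - x (Suc j) s)^2 \<partial>N) \<le> 4 * (1/4)^j" for j
  proof -
    have eq: "(x j s - x (Suc j) s)^2 = expneg (u j s) + expneg (u (Suc j) s) - 2 * expneg (v j s)" for s
      by (simp add: power2_eq_square algebra_simps x_sq flip: xv)
    have "(\<integral>s. (x j s - x (Suc j) s)^2 \<partial>N) = I (u j) + I (u (Suc j)) - 2 * I (v j)"
      unfolding eq I_def using int[OF um] int[OF vm] by simp
    moreover have "\<sigma> (m j) \<le> I (v j)"
      by (rule \<sigma>_le[OF v])
    moreover have "(1/4::real) ^ Suc j \<le> (1/4) ^ j"
      by simp
    ultimately show ?thesis
      using u(2)[of j] u(2)[of "Suc j"] \<sigma>m[of j] by linarith
  qed
  have x_diff: "\<bar>x j s - x (Suc j) s\<bar> \<le> 1" for j s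
    using x01[of j s] x01[of "Suc j" s] by linarith
  have int1: "integrable N (\<lambda>s. \<bar>x j s - x (Suc j) s\<bar>)" for j
    using x_diff by (intro N.integrable_const_bound[where B=1]) auto
  define C where "C = 2 + measure N (space N)"
  have L1: "(\<integral>s. \<bar>x j s - x (Suc j) s\<bar> \<partial>N) \<le> C * (1/2)^j" for j
  proof -
    have int2: "integrable N (\<lambda>s. (x j s - x (Suc j) s)^2)"
      using x_diff by (intro N.integrable_const_bound[where B=1]) (auto simp: abs_square_le_1)
    \<comment> \<open>A weighted inequality of arithmetic and geometric means: the weight 2^j
      balances the square bound of order (1/4)^j against the mass of N, leaving the summable rate
      (1/2)^j.\<close>
    have "\<bar>y\<bar> \<le> (2^j * y^2 + (1/2)^j) / 2" for y :: real
    proof -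
      have "0 \<le> (1/2)^j * (2^j * \<bar>y\<bar> - 1)^2"
        by simp
      also have "\<dots> = 2^j * y^2 - 2 * \<bar>y\<bar> + (1/2)^j"
        by (simp add: power2_eq_square algebra_simps power_one_over)
      finally show ?thesis by simp
    qed
    then have "(\<integral>s. \<bar>x j s - x (Suc j) s\<bar> \<partial>N) \<le> (\<integral>s. (2^j * (x j s - x (Suc j) s)^2 + (1/2)^j) / 2 \<partial>N)"
      using int1 int2 by (intro integral_mono) auto
    also have "\<dots> = (2^j * (\<integral>s. (x j s - x (Suc j) s)^2 \<partial>N) + (1/2)^j * measure N (space N)) / 2"
      using int2 by simp
    also have "\<dots> \<le> (2^j * (4 * (1/4)^j) + (1/2)^j * measure N (space N)) / 2"
      by (intro divide_right_mono add_right_mono mult_left_mono D) auto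
    also have "2^j * (4 * (1/4)^j) = 4 * (1/2::real)^j"
      by (simp add: power_mult_distrib[symmetric])
    also have "(4 * (1/2)^j + (1/2)^j * measure N (space N)) / 2 \<le> C * (1/2)^j"
      by (simp add: C_def algebra_simps)
    finally show ?thesis .
  qed
  have "(\<integral>\<^sup>+s. (\<Sum>j. ennreal \<bar>x j s - x (Suc j) s\<bar>) \<partial>N) = (\<Sum>j. \<integral>\<^sup>+s. ennreal \<bar>x j s - x (Suc j) s\<bar> \<partial>N)"
    by (rule nn_integral_suminf) simp
  also have "\<dots> \<le> (\<Sum>j. ennreal (C * (1/2)^j))"
    by (intro suminf_le) (auto simp: nn_integral_eq_integral[OF int1] L1 intro: ennreal_leI)
  also have "\<dots> < \<infinity>"
  proof -
    have "summable (\<lambda>j. C * (1/2)^j)"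
      by (intro summable_mult summable_geometric) simp
    moreover have "0 \<le> C"
      by (simp add: C_def)
    ultimately show ?thesis
      by (subst suminf_ennreal_eq[OF _ summable_sums]) auto
  qed
  finally have "AE s in N. (\<Sum>j. ennreal \<bar>x j s - x (Suc j) s\<bar>) \<noteq> \<infinity>"
    by (intro nn_integral_noteq_infinite) auto
  then have conv: "AE s in M. convergent (\<lambda>j. expneg (u j s))"
    unfolding AE_iff
  proof eventually_elim
    case (elim s)
    then have "summable (\<lambda>j. norm (x j s - x (Suc j) s))"
      using summable_suminf_not_top[of "\<lambda>j. \<bar>x j s - x (Suc j) s\<bar>"] by simp
    then have "summable (\<lambda>j. x (Suc j) s - x j s)"
      using summable_minus[OF summable_norm_cancel] by fastforce
    then have "(\<lambda>n. \<Sum>j<n. x (Suc j) s - x j s) \<longlonglongrightarrow> (\<Sum>j. x (Suc j) s - x j s)"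
      by (rule summable_LIMSEQ)
    then have "(\<lambda>n. (x n s - x 0 s) + x 0 s) \<longlonglongrightarrow> (\<Sum>j. x (Suc j) s - x j s) + x 0 s"
      by (intro tendsto_add tendsto_const) (simp add: sum_lessThan_telescope[of "\<lambda>j. x j s"])
    then have "convergent (\<lambda>j. x j s)"
      by (auto intro: convergentI)
    then have "convergent (\<lambda>j. x j s * x j s)"
      by (intro convergent_mult)
    then show ?case
      by (simp add: x_sq)
  qed
  \<comment> \<open>The liminf is defined everywhere and measurable, and Fatou bounds its integral.
    It is therefore finite almost everywhere, which is what \<open>tendsto_of_expneg\<close> needs
    in order to make it a limit.\<close>
  define g where "g s = liminf (\<lambda>j. u j s)" for s
  have gm [measurable]: "g \<in> borel_measurable M"
    unfolding g_def by measurable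
  have g_int: "(\<integral>\<^sup>+s. g s \<partial>M) \<le> c"
  proof -
    have "(\<integral>\<^sup>+s. g s \<partial>M) \<le> liminf (\<lambda>j. \<integral>\<^sup>+s. u j s \<partial>M)"
      unfolding g_def by (rule nn_integral_liminf) simp
    also have "\<dots> \<le> c"
      using bound[OF uK] by (intro Liminf_le) auto
    finally show ?thesis .
  qed
  then have "AE s in M. g s \<noteq> \<infinity>"
    using c by (intro nn_integral_noteq_infinite) auto
  with conv have lim: "AE s in M. (\<lambda>j. u j s) \<longlonglongrightarrow> g s \<and> g s \<noteq> \<top>"
  proof eventually_elim
    case (elim s)
    then show ?case
      unfolding g_def convergent_def by (auto intro: tendsto_of_expneg)
  qed
  have "(\<lambda>j. I (u j)) \<longlonglongrightarrow> I g"
    unfolding I_def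
  proof (rule integral_dominated_convergence[where w="\<lambda>_. 1"])
    show "AE s in N. (\<lambda>j. expneg (u j s)) \<longlonglongrightarrow> expneg (g s)"
      unfolding AE_iff using lim by eventually_elim (auto intro: tendsto_expneg)
  qed auto
  moreover have "(\<lambda>j. \<sigma>\<^sub>0 + (1/4)^j) \<longlonglongrightarrow> \<sigma>\<^sub>0 + 0"
    by (intro tendsto_intros LIMSEQ_power_zero) auto
  ultimately have Ig: "I g \<le> \<sigma>\<^sub>0"
    using u(2) by (intro LIMSEQ_le[of "\<lambda>j. I (u j)" "I g" "\<lambda>j. \<sigma>\<^sub>0 + (1/4)^j"]) (auto intro: less_imp_le)
  show thesis
  proof (rule that[OF uK gm g_int])
    show "AE s in M. (\<lambda>j. u j s) \<longlonglongrightarrow> g s"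
      using lim by auto
    fix e :: real assume "0 < e"
    then have "\<forall>\<^sub>F k in sequentially. \<sigma>\<^sub>0 - e < \<sigma> k"
      using \<sigma>\<^sub>0(1) by (intro order_tendstoD) auto
    then obtain k where "\<sigma>\<^sub>0 - e < \<sigma> k"
      by (auto simp: eventually_sequentially)
    then have "I g - e \<le> I h" if "h \<in> K k" for h
      using Ig \<sigma>_le[OF that] by linarith
    then show "\<exists>n. \<forall>h\<in>K n. (\<integral>s. expneg (g s) \<partial>N) - e \<le> (\<integral>s. expneg (h s) \<partial>N)"
      unfolding I_def by blast
  qed
qed

section \<open>Boxes in the index group\<close>

lemma lattice_eq_range: "(lattice :: (real^'d) set) = range (\<lambda>f. \<chi> i. of_int (f i))"
proof -
  have "x \<in> range (\<lambda>f. \<chi> i. of_int (f i))" if "x \<in> lattice" for x :: "real^'d"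
    using that by (intro image_eqI[where x="\<lambda>i. \<lfloor>x $ i\<rfloor>"]) (auto simp: lattice_def vec_eq_iff)
  then show ?thesis
    by (auto simp: lattice_def)
qed

lemma countable_lattice: "countable (lattice :: (real^'d) set)"
  unfolding lattice_eq_range by (intro countable_image countableI_type)

lemma space_lam [simp]: "space (lam disc) = Tset disc"
  by (simp add: lam_def Tset_def)

lemma Tset_zero [simp]: "0 \<in> Tset disc"
  by (simp add: Tset_def lattice_def)

lemma Tset_add: "t \<in> Tset disc \<Longrightarrow> r \<in> Tset disc \<Longrightarrow> t + r \<in> Tset disc"
  by (auto simp: Tset_def lattice_def split: if_splits)

lemma Tset_uminus: "t \<in> Tset disc \<Longrightarrow> - t \<in> Tset disc"
  by (auto simp: Tset_def lattice_def split: if_splits)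

lemma sigma_finite_lam: "sigma_finite_measure (lam disc)"
  by (simp add: lam_def sigma_finite_measure_count_space_countable countable_lattice sigma_finite_lborel)

lemma measurable_add_lam:
  "(\<lambda>(t, r). t + r) \<in> lam disc \<Otimes>\<^sub>M lam disc \<rightarrow>\<^sub>M (lam disc :: (real^'d) measure)"
proof (cases disc)
  case True
  then show ?thesis
    using Tset_add[of _ True]
    by (auto simp: lam_def pair_measure_countable countable_lattice Tset_def)
next
  case False
  have "sets (lborel \<Otimes>\<^sub>M lborel :: ((real^'d) \<times> (real^'d)) measure) = sets (borel \<Otimes>\<^sub>M borel)"
    by (intro sets_pair_measure_cong) simp_all
  then show ?thesis
    using False by (simp add: lam_def case_prod_beta cong: measurable_cong_sets)
qed

lemma nn_integral_lam_translate:
  fixes h :: "real^'d \<Rightarrow> ennreal"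
  assumes "r \<in> Tset disc" "h \<in> borel_measurable (lam disc)"
  shows "(\<integral>\<^sup>+t. h (t + r) \<partial>lam disc) = (\<integral>\<^sup>+t. h t \<partial>lam disc)"
proof (cases disc)
  case True
  have "bij_betw (\<lambda>t. t + r) lattice lattice"
    using assms(1) True Tset_add[of _ True] Tset_uminus[of _ True]
    by (intro bij_betwI[where g="\<lambda>t. t + (- r)"]) (auto simp: Tset_def Pi_iff simp del: add_uminus_conv_diff)
  then show ?thesis
    using True nn_integral_bij_count_space[of "\<lambda>t. t + r" lattice lattice h] by (simp add: lam_def)
next
  case False
  have "(\<integral>\<^sup>+t. h t \<partial>lborel) = (\<integral>\<^sup>+t. h t \<partial>distr lborel borel ((+) r))"
    by (simp add: lborel_distr_plus)
  also have "\<dots> = (\<integral>\<^sup>+t. h (r + t) \<partial>lborel)"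
    using assms(2) False by (intro nn_integral_distr) (auto simp: lam_def)
  finally show ?thesis
    using False by (simp add: lam_def add.commute)
qed

section \<open>Inclusions and volumes of boxes\<close>

lemma Bbox_sets [measurable]: "Bbox disc T \<in> sets (lam disc)"
proof (cases disc)
  case False
  then show ?thesis by (simp add: Bbox_def lam_def Tset_def)
qed (auto simp: Bbox_def lam_def Tset_def)

lemma Bbox_mono: "T \<le> T' \<Longrightarrow> Bbox disc T \<subseteq> Bbox disc T'"
  by (auto simp: Bbox_def intro: order_trans) (meson le_less_trans neg_le_iff_le)

lemma Bbox_add: "t \<in> Bbox disc T \<Longrightarrow> r \<in> Bbox disc T' \<Longrightarrow> t + r \<in> Bbox disc (T + T')"
  unfolding Bbox_def by (simp add: Tset_add) (smt (verit))

lemma Bbox_subset_Tset: "Bbox disc T \<subseteq> Tset disc"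
  by (auto simp: Bbox_def)

lemma ex_Bbox: "t \<in> Tset disc \<Longrightarrow> \<exists>n::nat. \<forall>m\<ge>n. t \<in> Bbox disc (real m)"
proof -
  assume t: "t \<in> Tset disc"
  obtain n :: nat where n: "norm t < real n"
    using reals_Archimedean2 by blast
  have "t \<in> Bbox disc (real m)" if "n \<le> m" for m
  proof -
    have "\<bar>t $ i\<bar> < real m" for i
      using component_le_norm_cart[of t i] n that by linarith
    then show ?thesis
      using t by (auto simp: Bbox_def abs_less_iff minus_less_iff intro: less_imp_le)
  qed
  then show ?thesis by blast
qed

text \<open>For non-integral \<open>T\<close> the number of lattice points in the box is not \<open>(2 T)\<^sup>d\<close>.\<close>

definition admissible :: "bool \<Rightarrow> real \<Rightarrow> bool" where
  "admissible disc T \<longleftrightarrow> 0 < T \<and> (disc \<longrightarrow> T \<in> \<int>)"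

lemma admissible_add_of_nat: "admissible disc T \<Longrightarrow> admissible disc (T + real n)"
  by (auto simp: admissible_def)

lemma Cvol_pos: "admissible disc T \<Longrightarrow> 0 < Cvol TYPE('d::finite) T"
  by (simp add: admissible_def Cvol_def)

text \<open>In the discrete case the half-open sides contain exactly 2 n integers each. In the
  continuous case the box is squeezed between an open and a closed cube of equal volume.\<close>

lemma emeasure_Bbox:
  assumes "admissible disc T"
  shows "emeasure (lam disc) (Bbox disc T :: (real^'d) set) = ennreal (Cvol TYPE('d) T)"
proof (cases disc)
  case True
  then obtain n where n: "T = of_int n" "0 < n"
    using assms by (auto simp: admissible_def elim!: Ints_cases)
  have eq: "(Bbox True T :: (real^'d) set) = (\<lambda>f. \<chi> i. of_int (f i)) ` PiE UNIV (\<lambda>_. {- n<..n})"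
  proof (intro equalityI subsetI)
    fix x :: "real^'d" assume x: "x \<in> Bbox True T"
    then obtain f where f: "x = (\<chi> i. of_int (f i))"
      by (auto simp: Bbox_def Tset_def lattice_eq_range)
    have "f i \<in> {- n<..n}" for i
      using x n by (auto simp: Bbox_def f simp flip: of_int_minus)
    then show "x \<in> (\<lambda>f. \<chi> i. of_int (f i)) ` PiE UNIV (\<lambda>_. {- n<..n})"
      by (auto simp: f PiE_UNIV_domain)
  next
    fix x :: "real^'d" assume "x \<in> (\<lambda>f. \<chi> i. of_int (f i)) ` PiE UNIV (\<lambda>_. {- n<..n})"
    then show "x \<in> Bbox True T"
      using n by (auto simp: Bbox_def Tset_def lattice_eq_range PiE_UNIV_domain Pi_iff simp flip: of_int_minus)
  qed
  have inj: "inj_on (\<lambda>f. \<chi> i. of_int (f i) :: real^'d) X" for X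
    by (auto simp: inj_on_def vec_eq_iff)
  have fin: "finite (Bbox True T :: (real^'d) set)"
    unfolding eq by (intro finite_imageI finite_PiE) auto
  have "card (Bbox True T :: (real^'d) set) = nat (2 * n) ^ CARD('d)"
    unfolding eq by (subst card_image[OF inj]) (simp add: card_PiE)
  moreover have "emeasure (lam True) (Bbox True T :: (real^'d) set) = card (Bbox True T :: (real^'d) set)"
    using fin unfolding lam_def by (simp add: emeasure_count_space Bbox_def Tset_def subset_iff)
  moreover have "real (nat (2 * n) ^ CARD('d)) = (2 * T) ^ CARD('d)"
    using n by simp
  ultimately show ?thesis
    using True by (simp add: Cvol_def ennreal_of_nat_eq_real_of_nat del: of_nat_power)
next
  case False
  have T: "0 < T"
    using assms by (simp add: admissible_def)
  define a b :: "real^'d" where "a = (\<chi> i. - T)" and "b = (\<chi> i. T)"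
  have ab: "\<forall>i\<in>Basis. a \<bullet> i \<le> b \<bullet> i"
    using T by (auto simp: a_def b_def Basis_vec_def inner_axis)
  have prod: "(\<Prod>i\<in>Basis. (b - a) \<bullet> i) = (2 * T) ^ CARD('d)"
  proof -
    have "(\<Prod>i\<in>Basis. (b - a) \<bullet> i) = (\<Prod>i\<in>(Basis :: (real^'d) set). 2 * T)"
      by (intro prod.cong) (auto simp: a_def b_def Basis_vec_def inner_axis)
    then show ?thesis by simp
  qed
  have "emeasure lborel (box a b) \<le> emeasure lborel (Bbox False T :: (real^'d) set)"
    using Bbox_sets[of False T]
    by (intro emeasure_mono) (auto simp: Bbox_def Tset_def lam_def a_def b_def mem_box_cart less_imp_le)
  moreover have "emeasure lborel (Bbox False T :: (real^'d) set) \<le> emeasure lborel (cbox a b)"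
    by (intro emeasure_mono) (auto simp: Bbox_def a_def b_def mem_box_cart less_imp_le)
  ultimately show ?thesis
    using False ab prod
    by (simp add: emeasure_lborel_box_eq emeasure_lborel_cbox_eq lam_def Cvol_def)
qed

lemma time_filter_le_at_top: "time_filter disc \<le> at_top"
proof (cases disc)
  case True
  have "filterlim real_of_int at_top at_top"
    by (rule filterlim_real_of_int_at_top)
  then show ?thesis
    using True by (simp add: time_filter_def filterlim_def)
qed (simp add: time_filter_def)

lemma eventually_admissible: "\<forall>\<^sub>F T in time_filter disc. admissible disc T"
proof (cases disc)
  case True
  then show ?thesis
    by (auto simp: time_filter_def eventually_filtermap admissible_def intro: eventually_gt_at_top)
next
  case False
  then show ?thesis
    by (simp add: time_filter_def admissible_def eventually_gt_at_top)
qed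

lemma time_filter_nontrivial: "time_filter disc \<noteq> bot"
  by (simp add: time_filter_def filtermap_bot_iff)

text \<open>The Foelner property of the boxes: relative to the box, a shell of fixed width c has
  volume (1 + c / T)^d - 1.\<close>

lemma Cvol_increment_tendsto_0:
  "((\<lambda>T. (Cvol TYPE('d::finite) (T + c) - Cvol TYPE('d) T) / Cvol TYPE('d) T) \<longlongrightarrow> 0) (time_filter disc)"
proof -
  have "((\<lambda>T. c / T) \<longlongrightarrow> 0) at_top"
    by (intro tendsto_divide_0[OF tendsto_const] filterlim_at_top_imp_at_infinity filterlim_ident)
  then have "((\<lambda>T. (1 + c / T) ^ CARD('d) - 1) \<longlongrightarrow> (1 + 0) ^ CARD('d) - 1) at_top"
    by (intro tendsto_intros)
  then have lim: "((\<lambda>T. (1 + c / T) ^ CARD('d) - 1) \<longlongrightarrow> 0) at_top"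
    by simp
  have "\<forall>\<^sub>F T in at_top. (1 + c / T) ^ CARD('d) - 1 = (Cvol TYPE('d) (T + c) - Cvol TYPE('d) T) / Cvol TYPE('d) T"
    using eventually_gt_at_top[of 0]
  proof eventually_elim
    case (elim T)
    then have "1 + c / T = (2 * (T + c)) / (2 * T)"
      by (simp add: field_simps)
    then show ?case
      using elim by (simp add: Cvol_def power_divide diff_divide_distrib)
  qed
  with lim have "((\<lambda>T. (Cvol TYPE('d) (T + c) - Cvol TYPE('d) T) / Cvol TYPE('d) T) \<longlongrightarrow> 0) at_top"
    by (subst (asm) tendsto_cong)
  then show ?thesis
    by (rule filterlim_mono[OF _ order_refl time_filter_le_at_top])
qed

section \<open>Inequalities up to a small integral\<close>

text \<open>The inequality is required everywhere: exceptional null sets are absorbed into the error,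
  which may be infinite there.\<close>

definition le_upto :: "'s measure \<Rightarrow> ennreal \<Rightarrow> ('s \<Rightarrow> ennreal) \<Rightarrow> ('s \<Rightarrow> ennreal) \<Rightarrow> bool" where
  "le_upto M e g h \<longleftrightarrow>
     (\<exists>k\<in>borel_measurable M. (\<forall>s\<in>space M. g s \<le> h s + k s) \<and> (\<integral>\<^sup>+s. k s \<partial>M) \<le> e)"

lemma le_uptoI:
  "k \<in> borel_measurable M \<Longrightarrow> (\<And>s. s \<in> space M \<Longrightarrow> g s \<le> h s + k s) \<Longrightarrow>
    (\<integral>\<^sup>+s. k s \<partial>M) \<le> e \<Longrightarrow> le_upto M e g h"
  unfolding le_upto_def by blast

lemma le_upto_mono: "le_upto M e g h \<Longrightarrow> e \<le> e' \<Longrightarrow> le_upto M e' g h"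
  unfolding le_upto_def by (blast intro: order_trans)

lemma le_upto_AE:
  assumes "AE s in M. g s \<le> h s"
  shows "le_upto M 0 g h"
proof -
  from assms obtain Z where Z: "{s \<in> space M. \<not> g s \<le> h s} \<subseteq> Z" "emeasure M Z = 0" "Z \<in> sets M"
    by (rule AE_E)
  show ?thesis
  proof (rule le_uptoI)
    show "(\<lambda>s. (\<top>::ennreal) * indicator Z s) \<in> borel_measurable M"
      using Z(3) by simp
    show "(\<integral>\<^sup>+s. \<top> * indicator Z s \<partial>M) \<le> 0"
      using Z by (simp add: nn_integral_cmult_indicator)
    show "g s \<le> h s + \<top> * indicator Z s" if "s \<in> space M" for s
      using Z(1) that by (auto simp: indicator_def)
  qed
qed

lemma le_upto_trans:
  assumes "le_upto M e g h" "le_upto M e' h i"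
  shows "le_upto M (e + e') g i"
proof -
  obtain k k' where [measurable]: "k \<in> borel_measurable M" "k' \<in> borel_measurable M"
    and k: "\<And>s. s \<in> space M \<Longrightarrow> g s \<le> h s + k s" "(\<integral>\<^sup>+s. k s \<partial>M) \<le> e"
    and k': "\<And>s. s \<in> space M \<Longrightarrow> h s \<le> i s + k' s" "(\<integral>\<^sup>+s. k' s \<partial>M) \<le> e'"
    using assms unfolding le_upto_def by blast
  show ?thesis
  proof (rule le_uptoI)
    show "(\<lambda>s. k s + k' s) \<in> borel_measurable M" by measurable
    show "(\<integral>\<^sup>+s. k s + k' s \<partial>M) \<le> e + e'"
      using k(2) k'(2) by (subst nn_integral_add) (auto intro: add_mono)
    fix s assume s: "s \<in> space M"
    have "g s \<le> h s + k s" by (rule k(1)[OF s])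
    also have "\<dots> \<le> (i s + k' s) + k s"
      by (intro add_right_mono k'(1)[OF s])
    finally show "g s \<le> i s + (k s + k' s)"
      by (simp add: ac_simps)
  qed
qed

text \<open>The errors are averaged too, so e does not double; without this the sets of almost
  invariant functions would not be closed under midpoints.\<close>

lemma le_upto_midpoint:
  assumes "le_upto M e g h" "le_upto M e g' h'"
  shows "le_upto M e (\<lambda>s. (g s + g' s) / 2) (\<lambda>s. (h s + h' s) / 2)"
proof -
  obtain k k' where [measurable]: "k \<in> borel_measurable M" "k' \<in> borel_measurable M"
    and k: "\<And>s. s \<in> space M \<Longrightarrow> g s \<le> h s + k s" "(\<integral>\<^sup>+s. k s \<partial>M) \<le> e"
    and k': "\<And>s. s \<in> space M \<Longrightarrow> g' s \<le> h' s + k' s" "(\<integral>\<^sup>+s. k' s \<partial>M) \<le> e"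
    using assms unfolding le_upto_def by blast
  show ?thesis
  proof (rule le_uptoI)
    show "(\<lambda>s. (k s + k' s) / 2) \<in> borel_measurable M" by measurable
    have "(\<integral>\<^sup>+s. (k s + k' s) / 2 \<partial>M) = ((\<integral>\<^sup>+s. k s \<partial>M) + (\<integral>\<^sup>+s. k' s \<partial>M)) / 2"
      by (simp add: nn_integral_divide nn_integral_add)
    also have "\<dots> \<le> (e + e) / 2"
      by (intro divide_right_mono_ennreal add_mono k(2) k'(2))
    also have "\<dots> = e"
      by (cases e) (auto simp: ennreal_divide_numeral ennreal_top_divide simp flip: ennreal_plus)
    finally show "(\<integral>\<^sup>+s. (k s + k' s) / 2 \<partial>M) \<le> e" .
    fix s assume s: "s \<in> space M"
    have "(g s + g' s) / 2 \<le> ((h s + k s) + (h' s + k' s)) / 2"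
      by (intro divide_right_mono_ennreal add_mono k(1)[OF s] k'(1)[OF s])
    then show "(g s + g' s) / 2 \<le> (h s + h' s) / 2 + (k s + k' s) / 2"
      by (simp add: ac_simps flip: add_divide_distrib_ennreal)
  qed
qed

lemma le_upto_cong:
  assumes "le_upto M e g h" "\<And>s. s \<in> space M \<Longrightarrow> g' s = g s" "\<And>s. s \<in> space M \<Longrightarrow> h' s = h s"
  shows "le_upto M e g' h'"
  using assms unfolding le_upto_def by simp

section \<open>Transfer operators and box averages\<close>

locale nonsingular_action =
  fixes disc :: bool
    and M :: "'s measure"
    and \<phi> :: "real^'d \<Rightarrow> 's \<Rightarrow> 's"
    and w :: "real^'d \<Rightarrow> 's \<Rightarrow> real"
  assumes sigma_fin: "sigma_finite_measure M"
    and meas: "\<And>t. t \<in> Tset disc \<Longrightarrow> \<phi> t \<in> M \<rightarrow>\<^sub>M M"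
    and abs_cont: "\<And>t. t \<in> Tset disc \<Longrightarrow> absolutely_continuous M (distr M M (\<phi> t))"
    and act0: "\<phi> 0 = id"
    and act_add: "\<And>u v. u \<in> Tset disc \<Longrightarrow> v \<in> Tset disc \<Longrightarrow> \<phi> (u + v) = \<phi> u \<circ> \<phi> v"
    and joint: "(\<lambda>(t, s). \<phi> t s) \<in> (lam disc \<Otimes>\<^sub>M M) \<rightarrow>\<^sub>M M"
    and w_pos: "\<And>t s. t \<in> Tset disc \<Longrightarrow> w t s > 0"
    and w_meas: "(\<lambda>(t, s). w t s) \<in> borel_measurable (lam disc \<Otimes>\<^sub>M M)"
    and w_RN: "\<And>t. t \<in> Tset disc \<Longrightarrow>
         AE s in M. ennreal (w t s) = RN_deriv M (distr M M (\<phi> (- t))) s"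
    and w_cocycle: "\<And>t h s. t \<in> Tset disc \<Longrightarrow> h \<in> Tset disc \<Longrightarrow>
         w (t + h) s = w h s * w t (\<phi> h s)"
begin

sublocale base: sigma_finite_measure M
  by (rule sigma_fin)

sublocale time: sigma_finite_measure "lam disc :: (real^'d) measure"
  by (rule sigma_finite_lam)

sublocale prod: pair_sigma_finite "lam disc :: (real^'d) measure" M ..

sublocale time_prod: pair_sigma_finite "lam disc :: (real^'d) measure" "lam disc :: (real^'d) measure" ..

text \<open>A pointwise version of the dual operator of \<open>\<phi> (- t)\<close> on nonnegative
  functions. Taking w as the density makes the group law hold at every point, and extended values
  permit Tonelli without integrability.\<close>

definition transfer :: "real^'d \<Rightarrow> ('s \<Rightarrow> ennreal) \<Rightarrow> 's \<Rightarrow> ennreal" where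
  "transfer t g s = ennreal (w t s) * g (\<phi> t s)"

definition mean :: "real \<Rightarrow> ('s \<Rightarrow> ennreal) \<Rightarrow> 's \<Rightarrow> ennreal" where
  "mean T g s = (\<integral>\<^sup>+t. transfer t g s * indicator (Bbox disc T) t \<partial>lam disc) / ennreal (Cvol TYPE('d) T)"

lemma space_\<phi>: "t \<in> Tset disc \<Longrightarrow> s \<in> space M \<Longrightarrow> \<phi> t s \<in> space M"
  using meas by (auto dest: measurable_space)

lemma \<phi>_uminus: "t \<in> Tset disc \<Longrightarrow> \<phi> t (\<phi> (- t) s) = s" "t \<in> Tset disc \<Longrightarrow> \<phi> (- t) (\<phi> t s) = s"
  using act_add[of t "- t"] act_add[of "- t" t] by (auto simp: Tset_uminus act0 fun_eq_iff)

lemma transfer_joint_measurable [measurable]: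
  assumes [measurable]: "g \<in> borel_measurable M"
  shows "(\<lambda>(t, s). transfer t g s) \<in> borel_measurable (lam disc \<Otimes>\<^sub>M M)"
proof -
  have [measurable]: "(\<lambda>x. \<phi> (fst x) (snd x)) \<in> (lam disc \<Otimes>\<^sub>M M) \<rightarrow>\<^sub>M M"
    using joint by (simp add: case_prod_beta)
  have [measurable]: "(\<lambda>x. w (fst x) (snd x)) \<in> borel_measurable (lam disc \<Otimes>\<^sub>M M)"
    using w_meas by (simp add: case_prod_beta)
  show ?thesis
    unfolding transfer_def case_prod_beta by measurable
qed

lemma transfer_measurable [measurable]:
  assumes "g \<in> borel_measurable M" "t \<in> Tset disc"
  shows "transfer t g \<in> borel_measurable M"
  using measurable_compose[OF measurable_Pair1' transfer_joint_measurable[OF assms(1)], of t] assms(2)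
  by simp

lemma transfer_measurable_time:
  assumes "g \<in> borel_measurable M" "s \<in> space M"
  shows "(\<lambda>t. transfer t g s) \<in> borel_measurable (lam disc)"
  using measurable_compose[OF measurable_Pair2' transfer_joint_measurable[OF assms(1)], of s] assms(2)
  by simp

lemma transfer_transfer:
  "t \<in> Tset disc \<Longrightarrow> r \<in> Tset disc \<Longrightarrow> transfer t (transfer r g) s = transfer (r + t) g s"
  using w_pos[of t s] w_pos[of r "\<phi> t s"]
  by (simp add: transfer_def w_cocycle act_add ennreal_mult mult.assoc less_imp_le)

lemma transfer_zero: "transfer 0 g s = g s"
proof -
  have "w 0 s = w 0 s * w 0 s"
    using w_cocycle[OF Tset_zero Tset_zero, of s] by (simp add: act0)
  then have "w 0 s = 1"
    using w_pos[OF Tset_zero, of s] by simp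
  then show ?thesis
    by (simp add: transfer_def act0)
qed

text \<open>The weight w t is the density of the image of M under \<open>\<phi> (- t)\<close>, and
  integrating against that image undoes the composition with \<open>\<phi> t\<close>.\<close>

lemma nn_integral_transfer:
  assumes t: "t \<in> Tset disc" and [measurable]: "g \<in> borel_measurable M"
  shows "(\<integral>\<^sup>+s. transfer t g s \<partial>M) = (\<integral>\<^sup>+s. g s \<partial>M)"
proof -
  note [measurable] = meas[OF t] meas[OF Tset_uminus[OF t]]
  have "(\<integral>\<^sup>+s. transfer t g s \<partial>M) = (\<integral>\<^sup>+s. RN_deriv M (distr M M (\<phi> (- t))) s * g (\<phi> t s) \<partial>M)"
    unfolding transfer_def using w_RN[OF t] by (intro nn_integral_cong_AE) auto
  also have "\<dots> = (\<integral>\<^sup>+s. g (\<phi> t s) \<partial>density M (RN_deriv M (distr M M (\<phi> (- t)))))"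
    by (subst nn_integral_density) auto
  also have "\<dots> = (\<integral>\<^sup>+s. g (\<phi> t s) \<partial>distr M M (\<phi> (- t)))"
    using abs_cont[OF Tset_uminus[OF t]] by (subst base.density_RN_deriv) auto
  also have "\<dots> = (\<integral>\<^sup>+s. g s \<partial>M)"
    by (subst nn_integral_distr) (auto simp: \<phi>_uminus[OF t])
  finally show ?thesis .
qed

text \<open>The isometry sends the indicator of a null set to a function with integral zero. As w is
  strictly positive, that function vanishes only where \<open>\<phi> t\<close> avoids the null
  set.\<close>

lemma AE_\<phi>:
  assumes t: "t \<in> Tset disc" and ae: "AE s in M. P s"
  shows "AE s in M. P (\<phi> t s)"
proof -
  from ae obtain Z where Z: "{s \<in> space M. \<not> P s} \<subseteq> Z" "emeasure M Z = 0" "Z \<in> sets M"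
    by (rule AE_E)
  have "(\<integral>\<^sup>+s. transfer t (indicator Z) s \<partial>M) = 0"
    using Z by (simp add: nn_integral_transfer[OF t])
  then have "AE s in M. transfer t (indicator Z) s = 0"
    using Z t by (subst (asm) nn_integral_0_iff_AE) auto
  then show ?thesis
    using AE_space
  proof eventually_elim
    case (elim s)
    then show ?case
      using Z(1) w_pos[OF t, of s] space_\<phi>[OF t, of s]
      by (auto simp: transfer_def indicator_def split: if_splits)
  qed
qed

lemma transfer_mono: "(\<And>s. s \<in> space M \<Longrightarrow> g s \<le> h s) \<Longrightarrow> t \<in> Tset disc \<Longrightarrow> s \<in> space M \<Longrightarrow>
    transfer t g s \<le> transfer t h s"
  unfolding transfer_def by (simp add: mult_left_mono space_\<phi>)

lemma transfer_add: "transfer t (\<lambda>s. g s + h s) s = transfer t g s + transfer t h s"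
  by (simp add: transfer_def distrib_left)

lemma transfer_divide: "transfer t (\<lambda>s. g s / c) s = transfer t g s / c"
  by (simp add: transfer_def ennreal_times_divide)

lemma borel_measurable_transfer_set:
  assumes [measurable]: "g \<in> borel_measurable M" "A \<in> sets (lam disc)"
  shows "(\<lambda>s. \<integral>\<^sup>+t. transfer t g s * indicator A t \<partial>lam disc) \<in> borel_measurable M"
proof -
  have [measurable]: "(\<lambda>x. transfer (snd x) g (fst x)) \<in> borel_measurable (M \<Otimes>\<^sub>M lam disc)"
    using measurable_compose[OF measurable_pair_swap' transfer_joint_measurable[OF assms(1)]]
    by (simp add: case_prod_beta)
  show ?thesis
    by (rule time.borel_measurable_nn_integral) (simp add: case_prod_beta)
qed

section \<open>Box averages as positive isometric operators\<close>

lemma mean_measurable [measurable]: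
  assumes "g \<in> borel_measurable M"
  shows "mean T g \<in> borel_measurable M"
  using borel_measurable_transfer_set[OF assms Bbox_sets]
  unfolding mean_def[abs_def] by measurable

lemma mean_mono:
  "(\<And>s. s \<in> space M \<Longrightarrow> g s \<le> h s) \<Longrightarrow> s \<in> space M \<Longrightarrow> mean T g s \<le> mean T h s"
  unfolding mean_def
  by (intro divide_right_mono_ennreal nn_integral_mono mult_right_mono transfer_mono) auto

lemma mean_add:
  assumes "g \<in> borel_measurable M" "h \<in> borel_measurable M" "s \<in> space M"
  shows "mean T (\<lambda>s. g s + h s) s = mean T g s + mean T h s"
  using transfer_measurable_time[OF assms(1,3)] transfer_measurable_time[OF assms(2,3)]
  unfolding mean_def
  by (simp add: transfer_add distrib_right nn_integral_add add_divide_distrib_ennreal)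

lemma mean_divide:
  assumes "g \<in> borel_measurable M" "s \<in> space M"
  shows "mean T (\<lambda>s. g s / c) s = mean T g s / c"
  using transfer_measurable_time[OF assms] unfolding mean_def
  unfolding transfer_divide by (simp add: divide_ennreal_def mult_ac nn_integral_cmult)

text \<open>Tonelli together with the isometry. General sets of times are allowed because both boxes
  and the shells between them occur.\<close>

lemma nn_integral_transfer_set:
  assumes [measurable]: "g \<in> borel_measurable M" "A \<in> sets (lam disc)"
  shows "(\<integral>\<^sup>+s. (\<integral>\<^sup>+t. transfer t g s * indicator A t \<partial>lam disc) \<partial>M) = emeasure (lam disc) A * (\<integral>\<^sup>+s. g s \<partial>M)"
proof -
  have [measurable]: "(\<lambda>x. transfer (fst x) g (snd x)) \<in> borel_measurable (lam disc \<Otimes>\<^sub>M M)"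
    using transfer_joint_measurable[OF assms(1)] by (simp add: case_prod_beta)
  have "(\<integral>\<^sup>+s. (\<integral>\<^sup>+t. transfer t g s * indicator A t \<partial>lam disc) \<partial>M)
      = (\<integral>\<^sup>+t. (\<integral>\<^sup>+s. transfer t g s * indicator A t \<partial>M) \<partial>lam disc)"
    by (rule prod.Fubini') (simp add: case_prod_beta)
  also have "\<dots> = (\<integral>\<^sup>+t. (\<integral>\<^sup>+s. g s \<partial>M) * indicator A t \<partial>lam disc)"
    by (intro nn_integral_cong) (simp add: nn_integral_multc nn_integral_transfer)
  also have "\<dots> = emeasure (lam disc) A * (\<integral>\<^sup>+s. g s \<partial>M)"
    by (subst nn_integral_cmult_indicator) (auto simp: mult.commute)
  finally show ?thesis .
qed

lemma nn_integral_mean: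
  assumes "admissible disc T" and "g \<in> borel_measurable M"
  shows "(\<integral>\<^sup>+s. mean T g s \<partial>M) = (\<integral>\<^sup>+s. g s \<partial>M)"
proof -
  have "(\<integral>\<^sup>+s. mean T g s \<partial>M) = emeasure (lam disc) (Bbox disc T :: (real^'d) set) * (\<integral>\<^sup>+s. g s \<partial>M) / ennreal (Cvol TYPE('d) T)"
    unfolding mean_def using assms(2)
    by (subst nn_integral_divide) (auto simp: nn_integral_transfer_set borel_measurable_transfer_set)
  then show ?thesis
    using Cvol_pos[OF assms(1), where 'd='d]
    by (simp add: emeasure_Bbox[OF assms(1)] mult.commute mult_divide_eq_ennreal)
qed

text \<open>Positivity and additivity carry the error k to \<open>mean T k\<close>, which has the
  same integral.\<close>

lemma le_upto_mean:
  assumes "admissible disc T" "h \<in> borel_measurable M" "le_upto M e g h"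
  shows "le_upto M e (mean T g) (mean T h)"
proof -
  obtain k where [measurable]: "k \<in> borel_measurable M"
    and k: "\<And>s. s \<in> space M \<Longrightarrow> g s \<le> h s + k s" "(\<integral>\<^sup>+s. k s \<partial>M) \<le> e"
    using assms(3) unfolding le_upto_def by blast
  show ?thesis
  proof (rule le_uptoI)
    show "mean T k \<in> borel_measurable M" by measurable
    show "(\<integral>\<^sup>+s. mean T k s \<partial>M) \<le> e"
      using k(2) assms(1) by (simp add: nn_integral_mean)
    show "mean T g s \<le> mean T h s + mean T k s" if "s \<in> space M" for s
    proof -
      have "mean T g s \<le> mean T (\<lambda>s. h s + k s) s"
        using k(1) that by (intro mean_mono)
      then show ?thesis
        using assms(2) that by (simp add: mean_add)
    qed
  qed
qed

text \<open>A translated box is contained in a slightly larger one; \<open>excess\<close> is the contribution of the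
  resulting shell, whose volume is negligible.\<close>

definition excess :: "real \<Rightarrow> nat \<Rightarrow> ('s \<Rightarrow> ennreal) \<Rightarrow> 's \<Rightarrow> ennreal" where
  "excess T m f s =
     (\<integral>\<^sup>+t. transfer t f s * indicator (Bbox disc (T + real m) - Bbox disc T) t \<partial>lam disc) / ennreal (Cvol TYPE('d) T)"

lemma excess_measurable [measurable]:
  assumes "f \<in> borel_measurable M"
  shows "excess T m f \<in> borel_measurable M"
proof -
  have [measurable]: "(\<lambda>s. \<integral>\<^sup>+t. transfer t f s * indicator (Bbox disc (T + real m) - Bbox disc T) t \<partial>lam disc)
      \<in> borel_measurable M"
    using assms by (intro borel_measurable_transfer_set) auto
  show ?thesis
    unfolding excess_def[abs_def] by measurable
qed

lemma nn_integral_excess: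
  assumes T: "admissible disc T" and f: "f \<in> borel_measurable M"
  shows "(\<integral>\<^sup>+s. excess T m f s \<partial>M) =
    (\<integral>\<^sup>+s. f s \<partial>M) * ennreal ((Cvol TYPE('d) (T + real m) - Cvol TYPE('d) T) / Cvol TYPE('d) T)"
proof -
  note pos = Cvol_pos[OF T, where 'd='d] Cvol_pos[OF admissible_add_of_nat[OF T], of m, where 'd='d]
  have "emeasure (lam disc) (Bbox disc (T + real m) - Bbox disc T :: (real^'d) set)
      = ennreal (Cvol TYPE('d) (T + real m)) - ennreal (Cvol TYPE('d) T)"
    using T by (subst emeasure_Diff) (auto simp: emeasure_Bbox admissible_add_of_nat intro!: Bbox_mono)
  also have "\<dots> = ennreal (Cvol TYPE('d) (T + real m) - Cvol TYPE('d) T)"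
    using pos by (simp add: ennreal_minus)
  finally have eq: "emeasure (lam disc) (Bbox disc (T + real m) - Bbox disc T :: (real^'d) set)
    = ennreal (Cvol TYPE('d) (T + real m) - Cvol TYPE('d) T)" .
  have "Cvol TYPE('d) T \<le> Cvol TYPE('d) (T + real m)"
    unfolding Cvol_def using T by (intro power_mono) (auto simp: admissible_def)
  then have "ennreal ((Cvol TYPE('d) (T + real m) - Cvol TYPE('d) T) / Cvol TYPE('d) T)
    = ennreal (Cvol TYPE('d) (T + real m) - Cvol TYPE('d) T) / ennreal (Cvol TYPE('d) T)"
    using pos by (simp add: divide_ennreal)
  then show ?thesis
    unfolding excess_def using f
    by (subst nn_integral_divide)
      (auto simp: nn_integral_transfer_set borel_measurable_transfer_set eq ennreal_times_divide mult.commute)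
qed

lemma excess_small:
  assumes f: "f \<in> borel_measurable M" and fin: "(\<integral>\<^sup>+s. f s \<partial>M) < \<infinity>" and e: "0 < e"
  shows "\<forall>\<^sub>F T in time_filter disc. (\<integral>\<^sup>+s. excess T m f s \<partial>M) \<le> ennreal e"
proof -
  obtain c where c: "0 \<le> c" "(\<integral>\<^sup>+s. f s \<partial>M) = ennreal c"
    using fin by (cases "\<integral>\<^sup>+s. f s \<partial>M") auto
  have "((\<lambda>T. c * ((Cvol TYPE('d) (T + real m) - Cvol TYPE('d) T) / Cvol TYPE('d) T)) \<longlongrightarrow> c * 0) (time_filter disc)"
    by (intro tendsto_intros Cvol_increment_tendsto_0)
  then have "\<forall>\<^sub>F T in time_filter disc. c * ((Cvol TYPE('d) (T + real m) - Cvol TYPE('d) T) / Cvol TYPE('d) T) < e"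
    using e by (intro order_tendstoD) auto
  with eventually_admissible show ?thesis
  proof eventually_elim
    case (elim T)
    then show ?case
      using c by (simp add: nn_integral_excess[OF _ f] ennreal_mult'[symmetric] ennreal_leI)
  qed
qed

text \<open>Translation invariance of the time measure moves the shift by r from the integrand to
  the box, and the shifted box lies in the one of radius T + m. The estimate is one-sided; equality
  is recovered in the limit by \<open>invariant_if_subinvariant\<close>.\<close>

lemma shifted_mean_le:
  assumes r: "r \<in> Bbox disc (real m)" and f: "f \<in> borel_measurable M" and s: "s \<in> space M"
  shows "(\<integral>\<^sup>+t. transfer (t + r) f s * indicator (Bbox disc T) t \<partial>lam disc) / ennreal (Cvol TYPE('d) T)
    \<le> mean T f s + excess T m f s"
proof -
  note [measurable] = transfer_measurable_time[OF f s]
  have "(\<integral>\<^sup>+t. transfer (t + r) f s * indicator (Bbox disc T) t \<partial>lam disc)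
      \<le> (\<integral>\<^sup>+t. transfer (t + r) f s * indicator (Bbox disc (T + real m)) (t + r) \<partial>lam disc)"
    using r by (intro nn_integral_mono mult_left_mono) (auto simp: indicator_def Bbox_add)
  also have "\<dots> = (\<integral>\<^sup>+t. transfer t f s * indicator (Bbox disc (T + real m)) t \<partial>lam disc)"
    using r Bbox_subset_Tset
    by (intro nn_integral_lam_translate[where h="\<lambda>t. transfer t f s * indicator (Bbox disc (T + real m)) t"]) auto
  also have "\<dots> \<le> (\<integral>\<^sup>+t. transfer t f s * indicator (Bbox disc T) t
      + transfer t f s * indicator (Bbox disc (T + real m) - Bbox disc T) t \<partial>lam disc)"
    by (intro nn_integral_mono) (auto simp: indicator_def)
  also have "\<dots> = (\<integral>\<^sup>+t. transfer t f s * indicator (Bbox disc T) t \<partial>lam disc)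
      + (\<integral>\<^sup>+t. transfer t f s * indicator (Bbox disc (T + real m) - Bbox disc T) t \<partial>lam disc)"
    by (intro nn_integral_add) auto
  finally show ?thesis
    unfolding mean_def excess_def
    by (simp add: divide_right_mono_ennreal flip: add_divide_distrib_ennreal)
qed

lemma transfer_mean:
  assumes r: "r \<in> Tset disc" and f: "f \<in> borel_measurable M" and s: "s \<in> space M"
  shows "transfer r (mean T f) s =
    (\<integral>\<^sup>+t. transfer (t + r) f s * indicator (Bbox disc T) t \<partial>lam disc) / ennreal (Cvol TYPE('d) T)"
proof -
  note [measurable] = transfer_measurable_time[OF f space_\<phi>[OF r s]]
  have "ennreal (w r s) * (\<integral>\<^sup>+t. transfer t f (\<phi> r s) * indicator (Bbox disc T) t \<partial>lam disc)
      = (\<integral>\<^sup>+t. ennreal (w r s) * (transfer t f (\<phi> r s) * indicator (Bbox disc T) t) \<partial>lam disc)"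
    by (intro nn_integral_cmult[symmetric]) auto
  also have "\<dots> = (\<integral>\<^sup>+t. transfer (t + r) f s * indicator (Bbox disc T) t \<partial>lam disc)"
  proof (rule nn_integral_cong)
    fix t :: "real^'d" assume "t \<in> space (lam disc)"
    then have "ennreal (w r s) * transfer t f (\<phi> r s) = transfer (t + r) f s"
      using transfer_transfer[OF r, of t f s] by (simp add: transfer_def[of r])
    then show "ennreal (w r s) * (transfer t f (\<phi> r s) * indicator (Bbox disc T) t)
        = transfer (t + r) f s * indicator (Bbox disc T) t"
      by (simp add: mult.assoc[symmetric])
  qed
  finally show ?thesis
    by (simp add: transfer_def[of r] mean_def ennreal_times_divide)
qed

text \<open>By commutativity and Tonelli the iterated average is an average, over r in the box of
  radius R, of shifted averages over the box of radius T. By \<open>shifted_mean_le\<close> each of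
  them is bounded by the right side, which does not depend on r.\<close>

lemma mean_mean_le:
  assumes R: "admissible disc R" "R \<le> real m" and f: "f \<in> borel_measurable M" and s: "s \<in> space M"
  shows "mean T (mean R f) s \<le> mean T f s + excess T m f s"
proof -
  let ?C = "\<lambda>T. ennreal (Cvol TYPE('d) T)"
  have h: "(\<lambda>t. transfer t f s) \<in> borel_measurable (lam disc)"
    by (rule transfer_measurable_time[OF f s])
  have pair1 [measurable]: "(\<lambda>x. transfer (fst x + snd x) f s) \<in> borel_measurable (lam disc \<Otimes>\<^sub>M lam disc)"
    using measurable_compose[OF measurable_add_lam h] by (simp add: case_prod_beta)
  have pair2 [measurable]: "(\<lambda>x. transfer (snd x + fst x) f s) \<in> borel_measurable (lam disc \<Otimes>\<^sub>M lam disc)"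
    using pair1 by (simp add: add.commute)
  have [measurable]: "(\<lambda>t. transfer (t + r) f s) \<in> borel_measurable (lam disc)" if "r \<in> Tset disc" for r
    using measurable_compose[OF measurable_compose[OF measurable_Pair2' measurable_add_lam] h, of r] that by simp
  define Y where "Y T r = (\<integral>\<^sup>+t. transfer (t + r) f s * indicator (Bbox disc T) t \<partial>lam disc)" for T r
  have [measurable]: "Y T \<in> borel_measurable (lam disc)" for T
    unfolding Y_def[abs_def] by (rule time.borel_measurable_nn_integral) (simp add: case_prod_beta)
  have Y_mult: "Y T r * c = (\<integral>\<^sup>+t. transfer (t + r) f s * indicator (Bbox disc T) t * c \<partial>lam disc)"
    if "r \<in> Tset disc" for T r c
    unfolding Y_def using that by (intro nn_integral_multc[symmetric]) simp
  have swap: "(\<integral>\<^sup>+t. Y R t * indicator (Bbox disc T) t \<partial>lam disc) = (\<integral>\<^sup>+r. Y T r * indicator (Bbox disc R) r \<partial>lam disc)"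
  proof -
    have "(\<integral>\<^sup>+t. Y R t * indicator (Bbox disc T) t \<partial>lam disc)
        = (\<integral>\<^sup>+t. (\<integral>\<^sup>+r. transfer (r + t) f s * indicator (Bbox disc R) r * indicator (Bbox disc T) t \<partial>lam disc) \<partial>lam disc)"
      by (intro nn_integral_cong) (simp add: Y_mult)
    also have "\<dots> = (\<integral>\<^sup>+r. (\<integral>\<^sup>+t. transfer (r + t) f s * indicator (Bbox disc R) r * indicator (Bbox disc T) t \<partial>lam disc) \<partial>lam disc)"
      by (rule time_prod.Fubini') (simp add: case_prod_beta)
    also have "\<dots> = (\<integral>\<^sup>+r. Y T r * indicator (Bbox disc R) r \<partial>lam disc)"
      by (intro nn_integral_cong) (simp add: Y_mult add.commute mult_ac)
    finally show ?thesis .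
  qed
  have "mean T (mean R f) s = (\<integral>\<^sup>+t. Y R t / ?C R * indicator (Bbox disc T) t \<partial>lam disc) / ?C T"
    unfolding mean_def[of T] Y_def using transfer_mean[OF _ f s]
    by (intro arg_cong2[where f="(/)"] nn_integral_cong) auto
  also have "\<dots> = (\<integral>\<^sup>+t. Y R t * indicator (Bbox disc T) t / ?C R \<partial>lam disc) / ?C T"
    by (simp add: divide_ennreal_def mult_ac)
  also have "\<dots> = (\<integral>\<^sup>+t. Y R t * indicator (Bbox disc T) t \<partial>lam disc) / ?C R / ?C T"
    by (subst nn_integral_divide) auto
  also have "\<dots> = (\<integral>\<^sup>+r. Y T r * indicator (Bbox disc R) r \<partial>lam disc) / ?C T / ?C R"
    unfolding swap by (simp add: divide_ennreal_def mult_ac)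
  also have "\<dots> = (\<integral>\<^sup>+r. Y T r * indicator (Bbox disc R) r / ?C T \<partial>lam disc) / ?C R"
    by (subst nn_integral_divide) auto
  also have "\<dots> \<le> (\<integral>\<^sup>+r. (mean T f s + excess T m f s) * indicator (Bbox disc R) r \<partial>(lam disc :: (real^'d) measure)) / ?C R"
  proof (intro divide_right_mono_ennreal nn_integral_mono)
    fix r :: "real^'d"
    show "Y T r * indicator (Bbox disc R) r / ?C T \<le> (mean T f s + excess T m f s) * indicator (Bbox disc R) r"
    proof (cases "r \<in> Bbox disc R")
      case True
      then have "r \<in> Bbox disc (real m)"
        using Bbox_mono[OF R(2)] by blast
      then show ?thesis
        using True shifted_mean_le[OF _ f s, of r m T] by (simp add: Y_def)
    qed simp
  qed
  also have "\<dots> = mean T f s + excess T m f s"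
    using Cvol_pos[OF R(1), where 'd='d]
    by (subst nn_integral_cmult_indicator) (auto simp: emeasure_Bbox[OF R(1)] mult_divide_eq_ennreal)
  finally show ?thesis .
qed

section \<open>The stochastic ergodic theorem\<close>

text \<open>An abstract stand-in for the convex hull of the averages of \<open>f\<close> over large boxes; only these
  properties of its elements matter, and they are evidently preserved by midpoints.\<close>

definition almost_invariant_averages :: "('s \<Rightarrow> ennreal) \<Rightarrow> nat \<Rightarrow> ('s \<Rightarrow> ennreal) set" where
  "almost_invariant_averages f n = {g \<in> borel_measurable M.
     (\<integral>\<^sup>+s. g s \<partial>M) \<le> (\<integral>\<^sup>+s. f s \<partial>M) \<and>
     (\<forall>e>0. \<forall>\<^sub>F T in time_filter disc. le_upto M (ennreal e) (mean T g) (mean T f)) \<and>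
     (\<forall>t\<in>Bbox disc (real n). le_upto M (ennreal ((1/2)^n)) (transfer t g) g)}"

lemma decseq_almost_invariant_averages: "decseq (almost_invariant_averages f)"
proof (intro decseq_SucI subsetI)
  fix n g assume g: "g \<in> almost_invariant_averages f (Suc n)"
  have "ennreal ((1/2)^Suc n) \<le> ennreal ((1/2)^n)"
    by (intro ennreal_leI) simp
  moreover have "Bbox disc (real n) \<subseteq> Bbox disc (real (Suc n))"
    by (intro Bbox_mono) simp
  ultimately show "g \<in> almost_invariant_averages f n"
    using g unfolding almost_invariant_averages_def by (blast intro: le_upto_mono)
qed

lemma almost_invariant_averages_midpoint:
  assumes "g \<in> almost_invariant_averages f n" "h \<in> almost_invariant_averages f n"
    and f: "f \<in> borel_measurable M"
  shows "(\<lambda>s. (g s + h s) / 2) \<in> almost_invariant_averages f n"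
proof -
  have half: "(x + x) / 2 = x" for x :: ennreal
    by (cases x) (auto simp: ennreal_divide_numeral ennreal_top_divide simp flip: ennreal_plus)
  have [measurable]: "g \<in> borel_measurable M" "h \<in> borel_measurable M"
    using assms by (auto simp: almost_invariant_averages_def)
  have "(\<integral>\<^sup>+s. (g s + h s) / 2 \<partial>M) = ((\<integral>\<^sup>+s. g s \<partial>M) + (\<integral>\<^sup>+s. h s \<partial>M)) / 2"
    by (simp add: nn_integral_divide nn_integral_add)
  also have "\<dots> \<le> ((\<integral>\<^sup>+s. f s \<partial>M) + (\<integral>\<^sup>+s. f s \<partial>M)) / 2"
    using assms by (intro divide_right_mono_ennreal add_mono) (auto simp: almost_invariant_averages_def)
  finally have 1: "(\<integral>\<^sup>+s. (g s + h s) / 2 \<partial>M) \<le> (\<integral>\<^sup>+s. f s \<partial>M)"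
    by (simp add: half)
  have 2: "\<forall>\<^sub>F T in time_filter disc. le_upto M (ennreal e) (mean T (\<lambda>s. (g s + h s) / 2)) (mean T f)"
    if "0 < e" for e
  proof -
    have "\<forall>\<^sub>F T in time_filter disc. le_upto M (ennreal e) (mean T g) (mean T f)"
      "\<forall>\<^sub>F T in time_filter disc. le_upto M (ennreal e) (mean T h) (mean T f)"
      using assms that by (auto simp: almost_invariant_averages_def)
    then show ?thesis
    proof eventually_elim
      case (elim T)
      show ?case
        by (rule le_upto_cong[OF le_upto_midpoint[OF elim]]) (auto simp: mean_divide mean_add half)
    qed
  qed
  have 3: "le_upto M (ennreal ((1/2)^n)) (transfer t (\<lambda>s. (g s + h s) / 2)) (\<lambda>s. (g s + h s) / 2)"
    if "t \<in> Bbox disc (real n)" for t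
    by (rule le_upto_cong[OF le_upto_midpoint[of M _ "transfer t g" g "transfer t h" h]])
      (use assms that in \<open>auto simp: almost_invariant_averages_def transfer_divide transfer_add\<close>)
  show ?thesis
    using 1 2 3 by (simp add: almost_invariant_averages_def)
qed

text \<open>Negligible shells are used twice. Width n and a large radius R give the almost
  invariance; then, with R fixed, a width m at least R and T tending to infinity show that further
  averaging absorbs the average over R.\<close>

lemma eventually_mean_almost_invariant:
  assumes f: "f \<in> borel_measurable M" and fin: "(\<integral>\<^sup>+s. f s \<partial>M) < \<infinity>"
  shows "\<forall>\<^sub>F T in time_filter disc. mean T f \<in> almost_invariant_averages f n"
proof -
  have "\<forall>\<^sub>F T in time_filter disc. (\<integral>\<^sup>+s. excess T n f s \<partial>M) \<le> ennreal ((1/2)^n)"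
    by (intro excess_small[OF f fin]) simp
  with eventually_admissible show ?thesis
  proof eventually_elim
    case (elim R)
    obtain m :: nat where m: "R \<le> real m"
      using real_arch_simple by blast
    have 2: "\<forall>\<^sub>F T in time_filter disc. le_upto M (ennreal e) (mean T (mean R f)) (mean T f)"
      if "0 < e" for e
      using excess_small[OF f fin that, of m]
    proof eventually_elim
      case (elim T)
      then show ?case
        using f mean_mean_le[OF \<open>admissible disc R\<close> m f] by (intro le_uptoI[of "excess T m f"]) auto
    qed
    have 3: "le_upto M (ennreal ((1/2)^n)) (transfer t (mean R f)) (mean R f)"
      if "t \<in> Bbox disc (real n)" for t
    proof (rule le_uptoI)
      show "excess R n f \<in> borel_measurable M"
        using f by measurable
      show "transfer t (mean R f) s \<le> mean R f s + excess R n f s" if "s \<in> space M" for s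
        using \<open>t \<in> Bbox disc (real n)\<close> Bbox_subset_Tset shifted_mean_le[OF _ f that, of t n R]
        by (subst transfer_mean[OF _ f that]) auto
    qed (rule elim(2))
    show ?case
      using 2 3 f elim(1) by (simp add: almost_invariant_averages_def nn_integral_mean)
  qed
qed

section \<open>Exactly invariant functions and limits of almost invariant ones\<close>

lemma invariant_if_subinvariant:
  assumes "\<And>t. t \<in> Tset disc \<Longrightarrow> AE s in M. transfer t g s \<le> g s" and t: "t \<in> Tset disc"
  shows "AE s in M. transfer t g s = g s"
proof -
  have "AE s in M. transfer (- t) g (\<phi> t s) \<le> g (\<phi> t s)"
    by (rule AE_\<phi>[OF t assms(1)[OF Tset_uminus[OF t]]])
  then show ?thesis
    using assms(1)[OF t]
  proof eventually_elim
    case (elim s)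
    \<comment> \<open>Subinvariance under - t, evaluated at \<open>\<phi> t s\<close> and multiplied
      by the weight, is the reverse inequality.\<close>
    have "g s = transfer t (transfer (- t) g) s"
      using t by (simp add: transfer_transfer Tset_uminus transfer_zero)
    also have "\<dots> \<le> transfer t g s"
      unfolding transfer_def[of t] using elim(1) by (intro mult_left_mono) auto
    finally show ?case
      using elim(2) by simp
  qed
qed

text \<open>The exceptional null set depends on t. Exchanging the two quantifiers almost everywhere
  gives, for almost every s, invariance at almost every time, and this suffices under the time
  integral.\<close>

lemma mean_invariant:
  assumes T: "admissible disc T" and g: "g \<in> borel_measurable M"
    and inv: "\<And>t. t \<in> Tset disc \<Longrightarrow> AE s in M. transfer t g s = g s"
  shows "AE s in M. mean T g s = g s"
proof -
  have [measurable]: "(\<lambda>x. transfer (fst x) g (snd x)) \<in> borel_measurable (lam disc \<Otimes>\<^sub>M M)"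
    using transfer_joint_measurable[OF g] by (simp add: case_prod_beta)
  have "AE t in lam disc. AE s in M. transfer t g s = g s"
    by (rule AE_I2) (simp add: inv)
  then have "AE s in M. AE t in lam disc. transfer t g s = g s"
    using g by (subst (asm) prod.AE_commute) auto
  then show ?thesis
  proof eventually_elim
    case (elim s)
    have "(\<integral>\<^sup>+t. transfer t g s * indicator (Bbox disc T) t \<partial>lam disc)
        = (\<integral>\<^sup>+t. g s * indicator (Bbox disc T) t \<partial>(lam disc :: (real^'d) measure))"
      using elim by (intro nn_integral_cong_AE) auto
    also have "\<dots> = g s * ennreal (Cvol TYPE('d) T)"
      by (subst nn_integral_cmult_indicator) (auto simp: emeasure_Bbox[OF T])
    finally show ?case
      unfolding mean_def using Cvol_pos[OF T, where 'd='d] by (simp add: mult_divide_eq_ennreal)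
  qed
qed

text \<open>The errors have integrals at most (1/2)^n, so they are summable and hence tend to 0
  almost everywhere. The limit can be taken on both sides, at s and at \<open>\<phi> t s\<close>,
  because \<open>AE_\<phi>\<close> transports the convergence.\<close>

lemma subinvariant_limit:
  assumes u: "\<And>n. u n \<in> almost_invariant_averages f n"
    and lim: "AE s in M. (\<lambda>n. u n s) \<longlonglongrightarrow> g s" and t: "t \<in> Tset disc"
  shows "AE s in M. transfer t g s \<le> g s"
proof -
  obtain n0 where n0: "\<And>n. n0 \<le> n \<Longrightarrow> t \<in> Bbox disc (real n)"
    using ex_Bbox[OF t] by blast
  \<comment> \<open>For the finitely many n whose box may miss t the error is set to zero, so that
    the choice covers the whole sequence.\<close>
  have "\<exists>k\<in>borel_measurable M. (\<forall>s\<in>space M. n0 \<le> n \<longrightarrow> transfer t (u n) s \<le> u n s + k s)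
      \<and> (\<integral>\<^sup>+s. k s \<partial>M) \<le> ennreal ((1/2)^n)" for n
  proof (cases "n0 \<le> n")
    case True
    then show ?thesis
      using u[of n] n0[OF True] by (auto simp: almost_invariant_averages_def le_upto_def)
  next
    case False
    then show ?thesis
      by (intro bexI[of _ "\<lambda>_. 0"]) auto
  qed
  then obtain k where k: "\<And>n. k n \<in> borel_measurable M"
    "\<And>n s. s \<in> space M \<Longrightarrow> n0 \<le> n \<Longrightarrow> transfer t (u n) s \<le> u n s + k n s"
    "\<And>n. (\<integral>\<^sup>+s. k n s \<partial>M) \<le> ennreal ((1/2)^n)"
    by metis
  note [measurable] = k(1)
  have "(\<integral>\<^sup>+s. (\<Sum>n. k n s) \<partial>M) = (\<Sum>n. \<integral>\<^sup>+s. k n s \<partial>M)"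
    by (rule nn_integral_suminf) simp
  also have "\<dots> \<le> (\<Sum>n. ennreal ((1/2)^n))"
    by (intro suminf_le k(3)) auto
  also have "\<dots> < \<infinity>"
    by (subst suminf_ennreal_eq[OF _ geometric_sums]) auto
  finally have "AE s in M. (\<Sum>n. k n s) \<noteq> \<infinity>"
    by (intro nn_integral_noteq_infinite) auto
  then show ?thesis
    using lim AE_\<phi>[OF t lim] AE_space
  proof eventually_elim
    case (elim s)
    have fin: "k n s \<noteq> \<top>" for n
      using elim(1) sum_le_suminf[of "\<lambda>n. k n s" "{n}"] by (auto simp: top_unique)
    define r where "r n = enn2real (k n s)" for n
    have r: "0 \<le> r n" "k n s = ennreal (r n)" for n
      using fin[of n] by (auto simp: r_def less_top)
    have "summable r"
      using elim(1) r by (intro summable_suminf_not_top) auto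
    then have "(\<lambda>n. ennreal (r n)) \<longlonglongrightarrow> ennreal 0"
      by (intro tendsto_ennrealI summable_LIMSEQ_zero)
    then have k0: "(\<lambda>n. k n s) \<longlonglongrightarrow> 0"
      by (simp add: r)
    have "(\<lambda>n. transfer t (u n) s) \<longlonglongrightarrow> transfer t g s"
      unfolding transfer_def using elim(3) by (intro ennreal_tendsto_cmult) auto
    moreover have "(\<lambda>n. u n s + k n s) \<longlonglongrightarrow> g s + 0"
      by (intro tendsto_add elim(2) k0)
    ultimately show ?case
      using k(2)[OF elim(4)] by (intro LIMSEQ_le[of _ "transfer t g s" _ "g s"]) auto
  qed
qed

lemma stochastic_ergodic_nonneg:
  assumes f: "f \<in> borel_measurable M" and fin: "(\<integral>\<^sup>+s. f s \<partial>M) < \<infinity>"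
  obtains g where "g \<in> borel_measurable M" "(\<integral>\<^sup>+s. g s \<partial>M) < \<infinity>"
    "\<And>t. t \<in> Tset disc \<Longrightarrow> AE s in M. transfer t g s = g s"
    "stoch_conv M (\<lambda>T s. enn2real (mean T f s)) (\<lambda>s. enn2real (g s)) (time_filter disc)"
proof -
  obtain q :: "'s \<Rightarrow> real" where q [measurable]: "q \<in> borel_measurable M"
    and q_pos: "\<And>s. s \<in> space M \<Longrightarrow> 0 < q s" and q_le: "\<And>s. q s \<le> 1"
    and q_fin: "(\<integral>\<^sup>+s. ennreal (q s) \<partial>M) < \<infinity>"
    by (rule base.ex_bounded_integrable_weight) blast
  \<comment> \<open>A finite measure below M with the same null sets.\<close>
  define N where "N = density M (\<lambda>s. ennreal (q s))"
  have sets_N [measurable_cong]: "sets N = sets M"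
    by (simp add: N_def)
  have AE_N: "(AE s in N. P s) \<longleftrightarrow> (AE s in M. P s)" for P
    unfolding N_def by (subst AE_density) (auto intro!: AE_cong simp: q_pos)
  have N_le: "(\<integral>\<^sup>+s. h s \<partial>N) \<le> (\<integral>\<^sup>+s. h s \<partial>M)" if [measurable]: "h \<in> borel_measurable M" for h
  proof -
    have "ennreal (q s) * h s \<le> 1 * h s" for s
      using q_le[of s] by (intro mult_right_mono) auto
    then show ?thesis
      unfolding N_def by (subst nn_integral_density) (auto intro!: nn_integral_mono)
  qed
  have fin_N: "finite_measure N"
    using q_fin by (intro finite_measureI) (simp add: N_def emeasure_density less_top cong: nn_integral_cong)
  interpret N: finite_measure N by (rule fin_N)
  let ?K = "almost_invariant_averages f"
  have ne: "?K n \<noteq> {}" for n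
    using eventually_happens[OF eventually_mean_almost_invariant[OF f fin, of n]] time_filter_nontrivial by blast
  obtain u g where u: "\<And>n. u n \<in> ?K n" and g [measurable]: "g \<in> borel_measurable M"
    and g_int: "(\<integral>\<^sup>+s. g s \<partial>M) \<le> (\<integral>\<^sup>+s. f s \<partial>M)"
    and lim: "AE s in M. (\<lambda>n. u n s) \<longlonglongrightarrow> g s"
    and min: "\<And>e. 0 < e \<Longrightarrow> \<exists>n. \<forall>h\<in>?K n. (\<integral>s. expneg (g s) \<partial>N) - e \<le> (\<integral>s. expneg (h s) \<partial>N)"
  proof (rule minimizing_sequence_converges[OF fin_N sets_N AE_N ne decseq_almost_invariant_averages _ _ _ fin])
    show "(\<lambda>s. (g s + h s) / 2) \<in> ?K n" if "g \<in> ?K n" "h \<in> ?K n" for n g h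
      using that f by (rule almost_invariant_averages_midpoint)
  qed (auto simp: almost_invariant_averages_def)
  have um [measurable]: "u n \<in> borel_measurable M" for n
    using u[of n] by (simp add: almost_invariant_averages_def)
  have g_fin: "(\<integral>\<^sup>+s. g s \<partial>M) < \<infinity>"
    using g_int fin by (rule le_less_trans)
  then have g_finite: "AE s in M. g s \<noteq> \<infinity>"
    by (intro nn_integral_noteq_infinite) auto
  have inv: "AE s in M. transfer t g s = g s" if "t \<in> Tset disc" for t
    using subinvariant_limit[OF u lim] that by (rule invariant_if_subinvariant)
  \<comment> \<open>Only the lower half \<open>(g - u\<^sub>n)\<^sup>+\<close> of the error is dominated, by \<open>g\<close>, and hence small in \<open>L\<^sup>1\<close>.\<close>
  have lower: "\<forall>\<^sub>F T in time_filter disc. le_upto M (ennreal (2 * e)) g (mean T f)" if e: "0 < e" for e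
  proof -
    have "(\<lambda>n. \<integral>\<^sup>+s. g s - u n s \<partial>M) \<longlonglongrightarrow> (\<integral>\<^sup>+s. 0 \<partial>M)"
    proof (rule nn_integral_dominated_convergence[where w=g])
      show "AE s in M. (\<lambda>n. g s - u n s) \<longlonglongrightarrow> 0"
        using lim g_finite
      proof eventually_elim
        case (elim s)
        have "(\<lambda>n. g s - u n s) \<longlonglongrightarrow> g s - g s"
          using elim by (intro tendsto_diff_ennreal tendsto_const) auto
        then show ?case
          using elim(2) by simp
      qed
    qed (use g_fin in auto)
    then have "\<forall>\<^sub>F n in sequentially. (\<integral>\<^sup>+s. g s - u n s \<partial>M) < ennreal e"
      using e by (intro order_tendstoD) auto
    then obtain n where "(\<integral>\<^sup>+s. g s - u n s \<partial>M) < ennreal e"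
      using eventually_happens'[OF sequentially_bot] by blast
    then have n: "(\<integral>\<^sup>+s. g s - u n s \<partial>M) \<le> ennreal e"
      by (rule less_imp_le)
    have gu: "le_upto M (ennreal e) g (u n)"
    proof (rule le_uptoI[OF _ _ n])
      show "g s \<le> u n s + (g s - u n s)" for s
        using ennreal_minus_le_iff[of "g s" "u n s" "g s - u n s"] by simp
    qed simp
    have "\<forall>\<^sub>F T in time_filter disc. le_upto M (ennreal e) (mean T (u n)) (mean T f)"
      using u[of n] e by (simp add: almost_invariant_averages_def)
    with eventually_admissible show ?thesis
    proof eventually_elim
      case (elim T)
      \<comment> \<open>The chain runs from g to its average, then to the average of u n, then to
        the average of f, with errors 0, e and e.\<close>
      have "le_upto M 0 g (mean T g)"
        using mean_invariant[OF elim(1) g inv] by (intro le_upto_AE) auto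
      from le_upto_trans[OF le_upto_trans[OF this le_upto_mean[OF elim(1) um gu]] elim(2)]
      show ?case
        using e by (simp flip: ennreal_plus)
    qed
  qed
  define J where "J T = (\<integral>s. \<bar>expneg (mean T f s) - expneg (g s)\<bar> \<partial>N)" for T
  have int: "integrable N (\<lambda>s. expneg (h s))" if "h \<in> borel_measurable M" for h
    using that by (intro N.integrable_const_bound[where B=1]) auto
  have mean_m [measurable]: "mean T f \<in> borel_measurable M" for T
    using f by measurable
  have J_small: "\<forall>\<^sub>F T in time_filter disc. J T \<le> 5 * e" if e: "0 < e" for e
  proof -
    obtain n where n: "\<And>h. h \<in> ?K n \<Longrightarrow> (\<integral>s. expneg (g s) \<partial>N) - e \<le> (\<integral>s. expneg (h s) \<partial>N)"
      using min[OF e] by blast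
    show ?thesis
      using lower[OF e] eventually_mean_almost_invariant[OF f fin, of n]
    proof eventually_elim
      case (elim T)
      obtain k where [measurable]: "k \<in> borel_measurable M"
        and k: "\<And>s. s \<in> space M \<Longrightarrow> g s \<le> mean T f s + k s" "(\<integral>\<^sup>+s. k s \<partial>M) \<le> ennreal (2 * e)"
        using elim(1) unfolding le_upto_def by blast
      have int_k: "integrable N (\<lambda>s. 1 - expneg (k s))"
        by (intro Bochner_Integration.integrable_diff int) auto
      have "ennreal (\<integral>s. 1 - expneg (k s) \<partial>N) = (\<integral>\<^sup>+s. ennreal (1 - expneg (k s)) \<partial>N)"
        using int_k by (intro nn_integral_eq_integral[symmetric]) auto
      also have "\<dots> \<le> (\<integral>\<^sup>+s. k s \<partial>N)"
        by (intro nn_integral_mono one_minus_expneg_le)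
      also have "\<dots> \<le> ennreal (2 * e)"
        using N_le[of k] k(2) by simp
      finally have k_small: "(\<integral>s. 1 - expneg (k s) \<partial>N) \<le> 2 * e"
        using e by (subst (asm) ennreal_le_iff) auto
      \<comment> \<open>For d = exp (- A_T f) - exp (- g) one has |d| = 2 d^+ - d. The lower
        estimate bounds d^+ by a function of integral at most 2 e, and minimality bounds the
        integral of - d by e, which gives 5 e in total.\<close>
      have "J T \<le> (\<integral>s. 2 * (1 - expneg (k s)) - (expneg (mean T f s) - expneg (g s)) \<partial>N)"
        unfolding J_def
      proof (rule integral_mono)
        fix s assume "s \<in> space N"
        then have "g s \<le> mean T f s + k s"
          using k(1) by (simp add: N_def)
        from expneg_diff_le[OF this]
        show "\<bar>expneg (mean T f s) - expneg (g s)\<bar>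
            \<le> 2 * (1 - expneg (k s)) - (expneg (mean T f s) - expneg (g s))"
          using expneg_le_1[of "k s"] by (intro abs_leI) (simp_all add: algebra_simps)
      qed (use int int_k in auto)
      also have "\<dots> = 2 * (\<integral>s. 1 - expneg (k s) \<partial>N) - ((\<integral>s. expneg (mean T f s) \<partial>N) - (\<integral>s. expneg (g s) \<partial>N))"
        using int_k int[OF g] int[OF mean_m] by (simp only: Bochner_Integration.integral_diff integrable_mult_right integral_mult_right_zero Bochner_Integration.integrable_diff)
      finally show ?case
        using k_small n[OF elim(2)] by linarith
    qed
  qed
  have J_lim: "((\<lambda>T. ennreal (J T)) \<longlongrightarrow> 0) (time_filter disc)"
  proof -
    have "(J \<longlongrightarrow> 0) (time_filter disc)"
    proof (rule tendstoI)
      fix e :: real assume "0 < e"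
      then show "\<forall>\<^sub>F T in time_filter disc. dist (J T) 0 < e"
        using J_small[of "e / 10"]
        by (auto elim!: eventually_mono simp: J_def intro!: Bochner_Integration.integral_nonneg)
    qed
    then show ?thesis
      using tendsto_ennrealI by fastforce
  qed
  have "stoch_conv M (\<lambda>T s. enn2real (mean T f s)) (\<lambda>s. enn2real (g s)) (time_filter disc)"
    unfolding stoch_conv_def
  proof (intro allI impI ballI)
    fix \<epsilon> :: real and B assume \<epsilon>: "0 < \<epsilon>" and B: "B \<in> sets M" "emeasure M B < \<infinity>"
    define X where "X T = {s \<in> space M. \<epsilon> < \<bar>enn2real (mean T f s) - enn2real (g s)\<bar>}" for T
    \<comment> \<open>The density of N times the separation constant; it is positive almost
      everywhere because g is finite almost everywhere.\<close>
    define p where "p s = q s * (expneg (g s) * (1 - exp (- \<epsilon>)))" for s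
    have Xm [measurable]: "X T \<in> sets M" for T
      unfolding X_def by measurable
    have pm [measurable]: "p \<in> borel_measurable M"
      unfolding p_def by measurable
    have p_pos: "AE s in M. 0 < p s"
      using g_finite AE_space by eventually_elim (use \<epsilon> in \<open>auto simp: p_def expneg_def q_pos\<close>)
    have "\<forall>\<^sub>F T in time_filter disc. (\<integral>\<^sup>+s. ennreal (p s) * indicator (X T) s \<partial>M) \<le> ennreal (J T)"
      using eventually_admissible
    proof eventually_elim
      case (elim T)
      \<comment> \<open>Since \<open>enn2real\<close> sends infinity to 0, the separation estimate
        is available only where the average is finite; preservation of the integral provides this
        almost everywhere.\<close>
      have "(\<integral>\<^sup>+s. mean T f s \<partial>M) \<noteq> \<infinity>"
        using fin nn_integral_mean[OF elim f] by simp
      then have "AE s in M. mean T f s \<noteq> \<infinity>"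
        by (intro nn_integral_noteq_infinite) auto
      then have "AE s in M. ennreal (p s) * indicator (X T) s
          \<le> ennreal (q s) * ennreal \<bar>expneg (mean T f s) - expneg (g s)\<bar>"
        using g_finite AE_space
      proof eventually_elim
        case (elim s)
        show ?case
        proof (cases "s \<in> X T")
          case True
          then have "p s \<le> q s * \<bar>expneg (mean T f s) - expneg (g s)\<bar>"
            unfolding p_def using elim \<epsilon> q_pos[of s]
            by (intro mult_left_mono expneg_separation) (auto simp: X_def)
          then show ?thesis
            using True q_pos[OF elim(3)] by (simp add: ennreal_mult'[symmetric] ennreal_leI less_imp_le)
        qed simp
      qed
      then have "(\<integral>\<^sup>+s. ennreal (p s) * indicator (X T) s \<partial>M)
          \<le> (\<integral>\<^sup>+s. ennreal (q s) * ennreal \<bar>expneg (mean T f s) - expneg (g s)\<bar> \<partial>M)"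
        by (rule nn_integral_mono_AE)
      also have "\<dots> = (\<integral>\<^sup>+s. ennreal \<bar>expneg (mean T f s) - expneg (g s)\<bar> \<partial>N)"
        unfolding N_def by (subst nn_integral_density) auto
      also have "\<dots> = ennreal (J T)"
        unfolding J_def using int by (intro nn_integral_eq_integral) auto
      finally show ?case .
    qed
    then have "((\<lambda>T. \<integral>\<^sup>+s. ennreal (p s) * indicator (X T) s \<partial>M) \<longlongrightarrow> 0) (time_filter disc)"
      by (intro tendsto_sandwich[OF _ _ tendsto_const J_lim]) auto
    then have "((\<lambda>T. measure M (X T \<inter> B)) \<longlongrightarrow> 0) (time_filter disc)"
      by (rule measure_tendsto_0_of_weight[OF pm p_pos B Xm])
    then show "((\<lambda>T. measure M ({s \<in> space M. \<epsilon> < \<bar>enn2real (mean T f s) - enn2real (g s)\<bar>} \<inter> B)) \<longlongrightarrow> 0) (time_filter disc)"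
      by (simp add: X_def)
  qed
  then show thesis
    using that g g_fin inv by blast
qed

section \<open>Signed functions and the dual operator\<close>

lemma avg_eq_mean_diff:
  assumes T: "admissible disc T" and f0: "integrable M f0"
  shows "AE s in M. avg disc T (\<lambda>t s. w t s * f0 (\<phi> t s)) s
    = enn2real (mean T (\<lambda>s. ennreal (f0 s)) s) - enn2real (mean T (\<lambda>s. ennreal (- f0 s)) s)"
proof -
  let ?C = "Cvol TYPE('d) T"
  have [measurable]: "f0 \<in> borel_measurable M"
    using f0 by simp
  have mean_fin: "AE s in M. mean T (\<lambda>s. ennreal (h s)) s \<noteq> \<infinity>" if h: "integrable M h" for h :: "'s \<Rightarrow> real"
  proof (rule nn_integral_noteq_infinite)
    have [measurable]: "h \<in> borel_measurable M"
      using h by simp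
    then show "mean T (\<lambda>s. ennreal (h s)) \<in> borel_measurable M"
      by measurable
    have "(\<integral>\<^sup>+s. ennreal (h s) \<partial>M) \<le> (\<integral>\<^sup>+s. ennreal (norm (h s)) \<partial>M)"
      by (intro nn_integral_mono ennreal_leI) auto
    also have "\<dots> < \<infinity>"
      using h by (simp add: integrable_iff_bounded)
    finally show "(\<integral>\<^sup>+s. mean T (\<lambda>s. ennreal (h s)) s \<partial>M) \<noteq> \<infinity>"
      by (simp add: nn_integral_mean[OF T])
  qed
  have neg: "integrable M (\<lambda>s. - f0 s)"
    using f0 by simp
  show ?thesis
    using mean_fin[OF f0] mean_fin[OF neg] AE_space
  proof eventually_elim
    case (elim s)
    define F where "F t = indicator (Bbox disc T) t * (w t s * f0 (\<phi> t s))" for t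
    have F_meas [measurable]: "F \<in> borel_measurable (lam disc)"
    proof -
      have "(\<lambda>t. \<phi> t s) \<in> lam disc \<rightarrow>\<^sub>M M"
        using measurable_compose[OF measurable_Pair2' joint, of s] elim(3) by simp
      moreover have "(\<lambda>t. w t s) \<in> borel_measurable (lam disc)"
        using measurable_compose[OF measurable_Pair2' w_meas, of s] elim(3) by simp
      ultimately show ?thesis
        unfolding F_def[abs_def] by measurable
    qed
    have pos: "(\<integral>\<^sup>+t. ennreal (F t) \<partial>lam disc) = (\<integral>\<^sup>+t. transfer t (\<lambda>s. ennreal (f0 s)) s * indicator (Bbox disc T) t \<partial>lam disc)"
      by (intro nn_integral_cong)
        (auto simp: F_def transfer_def indicator_def ennreal_mult'[OF less_imp_le[OF w_pos]])
    have neg: "(\<integral>\<^sup>+t. ennreal (- F t) \<partial>lam disc) = (\<integral>\<^sup>+t. transfer t (\<lambda>s. ennreal (- f0 s)) s * indicator (Bbox disc T) t \<partial>lam disc)"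
      by (intro nn_integral_cong)
        (auto simp: F_def transfer_def indicator_def ennreal_mult'[OF less_imp_le[OF w_pos], symmetric])
    \<comment> \<open>An infinite time integral would remain infinite after division by the volume.
      Finiteness is essential: the integral of a non-integrable function is 0 by convention and
      would not split into parts.\<close>
    have fin: "(\<integral>\<^sup>+t. ennreal (F t) \<partial>lam disc) \<noteq> \<top>" "(\<integral>\<^sup>+t. ennreal (- F t) \<partial>lam disc) \<noteq> \<top>"
      unfolding pos neg using elim(1,2) Cvol_pos[OF T, where 'd='d]
      by (auto simp: mean_def ennreal_top_divide)
    then have "integrable (lam disc) F"
      by (simp add: real_integrable_def)
    then have "(LINT t : Bbox disc T | lam disc. w t s * f0 (\<phi> t s))
        = enn2real (\<integral>\<^sup>+t. ennreal (F t) \<partial>lam disc) - enn2real (\<integral>\<^sup>+t. ennreal (- F t) \<partial>lam disc)"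
      unfolding set_lebesgue_integral_def by (subst real_lebesgue_integral_def[symmetric]) (auto simp: F_def[abs_def])
    moreover have "enn2real (x / ennreal ?C) = enn2real x / ?C" for x
      using Cvol_pos[OF T, where 'd='d]
      by (cases x) (auto simp: divide_ennreal ennreal_top_divide)
    ultimately show ?case
      unfolding avg_def mean_def pos[symmetric] neg[symmetric] by (simp add: diff_divide_distrib)
  qed
qed

text \<open>Almost everywhere, w at - t is the density of the image of M under
  \<open>\<phi> t\<close>, and on the space the set-theoretic inverse of \<open>\<phi> t\<close> is
  \<open>\<phi> (- t)\<close>. The dual operator is thus the transfer at the reflected time.\<close>

lemma dual_op_eq:
  assumes t: "t \<in> Tset disc"
  shows "AE s in M. dual_op M (\<phi> t) g s = w (- t) s * g (\<phi> (- t) s)"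
  using w_RN[OF Tset_uminus[OF t]] AE_space
proof eventually_elim
  case (elim s)
  have "inv_into (space M) (\<phi> t) s = \<phi> (- t) s"
  proof (rule inv_into_f_eq)
    show "inj_on (\<phi> t) (space M)"
      by (metis inj_onI \<phi>_uminus(2)[OF t])
    show "\<phi> (- t) s \<in> space M"
      by (rule space_\<phi>[OF Tset_uminus[OF t] elim(2)])
  qed (rule \<phi>_uminus(1)[OF t])
  then show ?case
    using elim(1)[symmetric] w_pos[OF Tset_uminus[OF t], of s]
    by (simp add: dual_op_def less_imp_le)
qed

lemma stochastic_ergodic:
  assumes f0: "integrable M f0"
  shows "\<exists>ft. integrable M ft
    \<and> stoch_conv M (\<lambda>T. avg disc T (\<lambda>t s. w t s * f0 (\<phi> t s))) ft (time_filter disc)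
    \<and> (\<forall>t \<in> Tset disc. AE s in M. dual_op M (\<phi> t) ft s = ft s)"
proof -
  have [measurable]: "f0 \<in> borel_measurable M"
    using f0 by simp
  have fin: "(\<integral>\<^sup>+s. ennreal (f0 s) \<partial>M) < \<infinity>" "(\<integral>\<^sup>+s. ennreal (- f0 s) \<partial>M) < \<infinity>"
    using f0 by (auto simp: real_integrable_def less_top)
  obtain g where g [measurable]: "g \<in> borel_measurable M" and g_fin: "(\<integral>\<^sup>+s. g s \<partial>M) < \<infinity>"
    and g_inv: "\<And>t. t \<in> Tset disc \<Longrightarrow> AE s in M. transfer t g s = g s"
    and g_lim: "stoch_conv M (\<lambda>T s. enn2real (mean T (\<lambda>s. ennreal (f0 s)) s)) (\<lambda>s. enn2real (g s)) (time_filter disc)"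
    by (rule stochastic_ergodic_nonneg[OF _ fin(1)]) auto
  obtain h where h [measurable]: "h \<in> borel_measurable M" and h_fin: "(\<integral>\<^sup>+s. h s \<partial>M) < \<infinity>"
    and h_inv: "\<And>t. t \<in> Tset disc \<Longrightarrow> AE s in M. transfer t h s = h s"
    and h_lim: "stoch_conv M (\<lambda>T s. enn2real (mean T (\<lambda>s. ennreal (- f0 s)) s)) (\<lambda>s. enn2real (h s)) (time_filter disc)"
    by (rule stochastic_ergodic_nonneg[OF _ fin(2)]) auto
  have "integrable M (\<lambda>s. enn2real (g s) - enn2real (h s))"
    by (intro Bochner_Integration.integrable_diff integrable_enn2real_nn_integral g h g_fin h_fin)
  moreover have "stoch_conv M (\<lambda>T. avg disc T (\<lambda>t s. w t s * f0 (\<phi> t s))) (\<lambda>s. enn2real (g s) - enn2real (h s)) (time_filter disc)"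
    by (rule stoch_conv_diff[OF g_lim h_lim])
      (auto intro: eventually_mono[OF eventually_admissible avg_eq_mean_diff[OF _ f0]])
  moreover have "AE s in M. dual_op M (\<phi> t) (\<lambda>s. enn2real (g s) - enn2real (h s)) s = enn2real (g s) - enn2real (h s)"
    if t: "t \<in> Tset disc" for t
    using dual_op_eq[OF t, of "\<lambda>s. enn2real (g s) - enn2real (h s)"] g_inv[OF Tset_uminus[OF t]] h_inv[OF Tset_uminus[OF t]]
  proof eventually_elim
    case (elim s)
    \<comment> \<open>Since \<open>enn2real\<close> is multiplicative even at infinity, the points
      where g or h is infinite need no separate treatment.\<close>
    have "w (- t) s * enn2real (k (\<phi> (- t) s)) = enn2real (transfer (- t) k s)" for k
      using w_pos[OF Tset_uminus[OF t], of s] by (simp add: transfer_def enn2real_mult)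
    then show ?case
      using elim by (simp add: right_diff_distrib)
  qed
  ultimately show ?thesis
    by blast
qed

end

theorem mainTheorem4:
  fixes disc :: bool
    and M :: "'s::polish_space measure"
    and \<phi> :: "real^'d \<Rightarrow> 's \<Rightarrow> 's"
    and w :: "real^'d \<Rightarrow> 's \<Rightarrow> real"
    and f0 :: "'s \<Rightarrow> real"
  assumes sets_M: "sets M = sets borel"
    and sigma_fin: "sigma_finite_measure M"
    and meas: "\<And>t. t \<in> Tset disc \<Longrightarrow> \<phi> t \<in> M \<rightarrow>\<^sub>M M"
    and nonsing: "\<And>t. t \<in> Tset disc \<Longrightarrow>
         absolutely_continuous M (distr M M (\<phi> t)) \<and> absolutely_continuous (distr M M (\<phi> t)) M"
    and act0: "\<phi> 0 = id"
    and act_add: "\<And>u v. u \<in> Tset disc \<Longrightarrow> v \<in> Tset disc \<Longrightarrow> \<phi> (u + v) = \<phi> u \<circ> \<phi> v"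
    and joint: "(\<lambda>(t, s). \<phi> t s) \<in> (lam disc \<Otimes>\<^sub>M M) \<rightarrow>\<^sub>M M"
    and w_pos: "\<And>t s. t \<in> Tset disc \<Longrightarrow> w t s > 0"
    and w_meas: "(\<lambda>(t, s). w t s) \<in> borel_measurable (lam disc \<Otimes>\<^sub>M M)"
    and w_RN: "\<And>t. t \<in> Tset disc \<Longrightarrow>
         AE s in M. ennreal (w t s) = RN_deriv M (distr M M (\<phi> (- t))) s"
    and w_cocycle: "\<And>t h s. t \<in> Tset disc \<Longrightarrow> h \<in> Tset disc \<Longrightarrow>
         w (t + h) s = w h s * w t (\<phi> h s)"
    and f0_int: "integrable M f0"
  shows "\<exists>ft. integrable M ft
            \<and> stoch_conv M (\<lambda>T. avg disc T (\<lambda>t s. w t s * f0 (\<phi> t s))) ft (time_filter disc)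
            \<and> (\<forall>t \<in> Tset disc. AE s in M. dual_op M (\<phi> t) ft s = ft s)"
proof -
  interpret nonsingular_action disc M \<phi> w
  proof (rule nonsingular_action.intro)
    show "absolutely_continuous M (distr M M (\<phi> t))" if "t \<in> Tset disc" for t
      using nonsing[OF that] ..
  qed (fact assms)+
  show ?thesis
    using f0_int by (rule stochastic_ergodic)
qed

end
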